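(* Let $1\le d\le n$ and let $I_d\subseteq k[x_1,\dots,x_n]$ ($k$ a field) be the ideal generated by all square-free monomials of degree $d$. Suppose that $\widetilde{I_d}$ is a polarization of $I_d$, corresponding to the partitionings $\Sigma_i^d=P_{i,1}\cup\cdots\cup P_{i,r_i}$, $i=1,\dots,n$. Then the Alexander dual $D(\widetilde{I_d})$ is the polarization of $D(I_d)=I_{n-d+1}$ corresponding to the dual partitionings $\Sigma_i^{n-d+1}=P_{i,1}^c\cup\cdots\cup P_{i,r_i}^c$, $i=1,\dots,n$.
   Context: Polarization: Let $J$ be a monomial ideal in $S=k[x_1,\dots,x_n]$. A polarization of $J$ is a square-free monomial ideal $\widetilde J$ in $\widetilde S=k[x_i^{(j)} : 1\le i\le n,\ 1\le j\le r_i]$ such that the sequence $\sigma$ consisting of all $x_i^{(1)}-x_i^{(j)}$ ($1\le i\le n$, $2\le j\le r_i$) is a regular $\widetilde S/\widetilde J$-sequence and $\widetilde J\otimes \widetilde S/(\sigma)\cong J$ (substituting $x_i^{(j)}\mapsto x_i$ carries $\widetilde J$ to $J$). Alexander dual: if a square-free monomial ideal in a polynomial ring is generated by square-free monomials with supports $\sigma_1,\dots,\sigma_r$ (sets of variables), its Alexander dual $D(\cdot)$ is the ideal of the same ring generated by all square-free monomials whose support $\tau$ satisfies $\tau\cap\sigma_j\neq\emptyset$ for all $j$. Partitionings: let $\Gamma_d=\{\sigma\subseteq[n] : |\sigma|=d\}$ and $\Sigma_i^d=\{\sigma\in\Gamma_{d-1} : i\notin\sigma\}$. An ideal $\widetilde{I_d}$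 generated by monomials $m_\sigma=\prod_{i\in\sigma}x_i^{(a_{i,\sigma})}$, $\sigma\in\Gamma_d$, where for each $i$ the set of all $a_{i,\sigma}$ is $\{1,\dots,r_i\}$, corresponds to the partitionings $\Sigma_i^d=P_{i,1}\cup\cdots\cup P_{i,r_i}$ with $P_{i,j}=\{\sigma\in\Sigma_i^d : a_{i,\sigma\cup\{i\}}=j\}$. Conversely, partitionings $\Sigma_i^d=P_{i,1}\cup\dots\cup P_{i,r_i}$ ($1\le i\le n$) correspond to the ideal generated by the monomials $m_\sigma=\prod_{i\in\sigma}x_i^{(j)}$, $\sigma\in\Gamma_d$, where for each $i\in\sigma$ the index $j$ is the one with $\sigma\setminus\{i\}\in P_{i,j}$. Dual partitioning: $P_{i,j}^c=\{\sigma\subseteq[n] : i\notin\sigma,\ |\sigma|=n-d,\ [n]\setminus(\sigma\cup\{i\})\in P_{i,j}\}$, i.e. the set of complements in $[n]\setminus\{i\}$ of the elements of $P_{i,j}$; then $\Sigma_i^{n-d+1}=P_{i,1}^c\cup\cdots\cup P_{i,r_i}^c$. *)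

theory Defs
  imports "HOL-Library.Poly_Mapping" "HOL-Library.Disjoint_Sets"
    "HOL-Algebra.Module" "HOL-Algebra.QuotRing" "HOL-Algebra.Ideal_Product"
begin

text \<open>
  A polynomial over \<open>'k\<close> in variables of type \<open>'v\<close> is a finitely supported map from
  exponent vectors \<open>'v \<Rightarrow>\<^sub>0 nat\<close> to coefficients; the polynomial ring in a set \<open>V\<close> of
  variables is the subring of those polynomials in which only variables from \<open>V\<close> occur.
\<close>

type_synonym ('v, 'k) mpol = "('v \<Rightarrow>\<^sub>0 nat) \<Rightarrow>\<^sub>0 'k"

definition mpoly_ring :: "'v set \<Rightarrow> ('v, 'k::comm_ring_1) mpol ring" where
  "mpoly_ring V =
     \<lparr>carrier = {p. \<forall>m \<in> Poly_Mapping.keys p. Poly_Mapping.keys m \<subseteq> V},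
      mult = (*), one = 1, zero = 0, add = (+)\<rparr>"

definition mconst :: "'k \<Rightarrow> ('v, 'k::comm_ring_1) mpol" where
  "mconst c = Poly_Mapping.single 0 c"

definition mvar :: "'v \<Rightarrow> ('v, 'k::comm_ring_1) mpol" where
  "mvar v = Poly_Mapping.single (Poly_Mapping.single v 1) 1"

definition monom_of :: "('v \<Rightarrow>\<^sub>0 nat) \<Rightarrow> ('v, 'k::comm_ring_1) mpol" where
  "monom_of m = (\<Prod>v \<in> Poly_Mapping.keys m. mvar v ^ Poly_Mapping.lookup m v)"

definition sqfree_monom :: "'v set \<Rightarrow> ('v, 'k::comm_ring_1) mpol" where
  "sqfree_monom \<sigma> = (\<Prod>v \<in> \<sigma>. mvar v)"

definition msubst :: "('v \<Rightarrow> ('w, 'k) mpol) \<Rightarrow> ('v, 'k::comm_ring_1) mpol \<Rightarrow> ('w, 'k) mpol" where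
  "msubst g p = (\<Sum>m \<in> Poly_Mapping.keys p.
     mconst (Poly_Mapping.lookup p m) *
     (\<Prod>v \<in> Poly_Mapping.keys m. g v ^ Poly_Mapping.lookup m v))"

definition monomial_ideal :: "'v set \<Rightarrow> ('v, 'k::field) mpol set \<Rightarrow> bool" where
  "monomial_ideal V J \<longleftrightarrow>
     (\<exists>A. (\<forall>m \<in> A. Poly_Mapping.keys m \<subseteq> V) \<and> J = Idl\<^bsub>mpoly_ring V\<^esub> (monom_of ` A))"

definition sqfree_monomial_ideal :: "'v set \<Rightarrow> ('v, 'k::field) mpol set \<Rightarrow> bool" where
  "sqfree_monomial_ideal V J \<longleftrightarrow>
     (\<exists>A. A \<subseteq> Pow V \<and> J = Idl\<^bsub>mpoly_ring V\<^esub> (sqfree_monom ` A))"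

text \<open>
  The Alexander dual is defined from any family \<open>A\<close> of supports of square-free generators; that
  the result does not depend on \<open>A\<close> is shown in \<open>alexander_dual_Idl\<close> below.
\<close>

definition alexander_dual :: "'v set \<Rightarrow> ('v, 'k::field) mpol set \<Rightarrow> ('v, 'k) mpol set" where
  "alexander_dual V J = (THE D. \<exists>A. A \<subseteq> Pow V \<and> J = Idl\<^bsub>mpoly_ring V\<^esub> (sqfree_monom ` A) \<and>
     D = Idl\<^bsub>mpoly_ring V\<^esub> (sqfree_monom ` {\<tau>. \<tau> \<subseteq> V \<and> (\<forall>\<sigma> \<in> A. \<tau> \<inter> \<sigma> \<noteq> {})}))"

definition seq_times_module ::
  "('a, 'b) ring_scheme \<Rightarrow> ('a, 'c, 'd) module_scheme \<Rightarrow> 'a list \<Rightarrow> 'c set" where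
  "seq_times_module R M fs =
     {\<Oplus>\<^bsub>M\<^esub> i \<in> {..<length fs}. (fs ! i) \<odot>\<^bsub>M\<^esub> m i | m. m \<in> {..<length fs} \<rightarrow> carrier M}"

text \<open>
  For each \<open>i\<close>, the element \<open>fs ! i\<close> is a non-zero-divisor on \<open>M / (fs!0, \<dots>, fs!(i-1)) M\<close>, and
  \<open>M / (fs) M\<close> is non-zero.
\<close>

definition regular_sequence ::
  "('a, 'b) ring_scheme \<Rightarrow> ('a, 'c, 'd) module_scheme \<Rightarrow> 'a list \<Rightarrow> bool" where
  "regular_sequence R M fs \<longleftrightarrow>
     set fs \<subseteq> carrier R \<and>
     (\<forall>i < length fs. \<forall>m \<in> carrier M.
        (fs ! i) \<odot>\<^bsub>M\<^esub> m \<in> seq_times_module R M (take i fs) \<longrightarrow>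
        m \<in> seq_times_module R M (take i fs)) \<and>
     seq_times_module R M fs \<noteq> carrier M"

definition quot_module :: "('a, 'b) ring_scheme \<Rightarrow> 'a set \<Rightarrow> ('a, 'a set) module" where
  "quot_module R J =
     \<lparr>carrier = carrier (R Quot J), mult = mult (R Quot J), one = one (R Quot J),
      zero = zero (R Quot J), add = add (R Quot J),
      smult = (\<lambda>a X. (J +>\<^bsub>R\<^esub> a) \<otimes>\<^bsub>R Quot J\<^esub> X)\<rparr>"

text \<open>The pair \<open>(i, j)\<close> stands for the variable \<open>x\<^sub>i\<^bsup>(j)\<^esup>\<close>.\<close>

definition pol_vars :: "nat \<Rightarrow> (nat \<Rightarrow> nat) \<Rightarrow> (nat \<times> nat) set" where
  "pol_vars n r = {(i, j). i \<in> {1..n} \<and> j \<in> {1..r i}}"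

definition pol_seq :: "nat \<Rightarrow> (nat \<Rightarrow> nat) \<Rightarrow> (nat \<times> nat, 'k::field) mpol list" where
  "pol_seq n r =
     concat (map (\<lambda>i. map (\<lambda>j. mvar (i, 1) - mvar (i, j)) [2..<Suc (r i)]) [1..<Suc n])"

definition depol :: "(nat \<times> nat, 'k::field) mpol \<Rightarrow> (nat, 'k) mpol" where
  "depol = msubst (\<lambda>(i, j). mvar i)"

text \<open>
  With \<open>\<sigma>\<close> the sequence \<open>pol_seq n r\<close>, \<open>Jt \<otimes> St/(\<sigma>)\<close> is \<open>Jt / (\<sigma>)Jt\<close>.  The last two conjuncts say
  that the substitution \<open>x\<^sub>i\<^bsup>(j)\<^esup> \<mapsto> x\<^sub>i\<close> induces an isomorphism from it onto \<open>J\<close>: the image of \<open>Jt\<close>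
  is \<open>J\<close>, and the kernel on \<open>Jt\<close> is \<open>(\<sigma>)Jt\<close>.
\<close>

definition is_polarization ::
  "nat \<Rightarrow> (nat \<Rightarrow> nat) \<Rightarrow> (nat \<times> nat, 'k::field) mpol set \<Rightarrow> (nat, 'k) mpol set \<Rightarrow> bool" where
  "is_polarization n r Jt J \<longleftrightarrow>
     (let St = mpoly_ring (pol_vars n r) in
       (\<forall>i \<in> {1..n}. 1 \<le> r i) \<and>
       monomial_ideal {1..n} J \<and>
       sqfree_monomial_ideal (pol_vars n r) Jt \<and>
       regular_sequence St (quot_module St Jt) (pol_seq n r) \<and>
       depol ` Jt = J \<and>
       {f \<in> Jt. depol f = 0} = (Idl\<^bsub>St\<^esub> (set (pol_seq n r))) \<cdot>\<^bsub>St\<^esub> Jt)"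

definition Gam :: "nat \<Rightarrow> nat \<Rightarrow> nat set set" where
  "Gam n d = {\<sigma>. \<sigma> \<subseteq> {1..n} \<and> card \<sigma> = d}"

definition Sig :: "nat \<Rightarrow> nat \<Rightarrow> nat \<Rightarrow> nat set set" where
  "Sig n d i = {\<sigma> \<in> Gam n (d - 1). i \<notin> \<sigma>}"

definition sqfree_ideal :: "nat \<Rightarrow> nat \<Rightarrow> (nat, 'k::field) mpol set" where
  "sqfree_ideal n d = Idl\<^bsub>mpoly_ring {1..n}\<^esub> (sqfree_monom ` Gam n d)"

text \<open>
  The blocks are non-empty, because every value in \<open>{1..r i}\<close> occurs as an upper index of
  \<open>x\<^sub>i\<close> in some generator.
\<close>

definition partitionings ::
  "nat \<Rightarrow> nat \<Rightarrow> (nat \<Rightarrow> nat) \<Rightarrow> (nat \<Rightarrow> nat \<Rightarrow> nat set set) \<Rightarrow> bool" where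
  "partitionings n d r P \<longleftrightarrow>
     (\<forall>i \<in> {1..n}. disjoint_family_on (P i) {1..r i} \<and>
        (\<Union>j \<in> {1..r i}. P i j) = Sig n d i \<and>
        (\<forall>j \<in> {1..r i}. P i j \<noteq> {}))"

definition part_monom ::
  "(nat \<Rightarrow> nat) \<Rightarrow> (nat \<Rightarrow> nat \<Rightarrow> nat set set) \<Rightarrow> nat set \<Rightarrow> (nat \<times> nat, 'k::field) mpol" where
  "part_monom r P \<sigma> = (\<Prod>i \<in> \<sigma>. mvar (i, THE j. j \<in> {1..r i} \<and> \<sigma> - {i} \<in> P i j))"

definition part_ideal ::
  "nat \<Rightarrow> nat \<Rightarrow> (nat \<Rightarrow> nat) \<Rightarrow> (nat \<Rightarrow> nat \<Rightarrow> nat set set) \<Rightarrow> (nat \<times> nat, 'k::field) mpol set" where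
  "part_ideal n d r P = Idl\<^bsub>mpoly_ring (pol_vars n r)\<^esub> (part_monom r P ` Gam n d)"

definition dual_part ::
  "nat \<Rightarrow> nat \<Rightarrow> (nat \<Rightarrow> nat \<Rightarrow> nat set set) \<Rightarrow> nat \<Rightarrow> nat \<Rightarrow> nat set set" where
  "dual_part n d P i j =
     {\<sigma>. \<sigma> \<subseteq> {1..n} \<and> i \<notin> \<sigma> \<and> card \<sigma> = n - d \<and> {1..n} - (\<sigma> \<union> {i}) \<in> P i j}"

lemma cring_mpoly_ring: "cring (mpoly_ring V :: ('v, 'k::comm_ring_1) mpol ring)"
proof -
  have mult: "Poly_Mapping.keys m \<subseteq> V"
    if "\<forall>m \<in> Poly_Mapping.keys p. Poly_Mapping.keys m \<subseteq> V"
       "\<forall>m \<in> Poly_Mapping.keys q. Poly_Mapping.keys m \<subseteq> V"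
       "m \<in> Poly_Mapping.keys (p * q)" for m and p q :: "('v, 'k) mpol"
  proof -
    from that(3) keys_mult[of p q] obtain a b
      where "a \<in> Poly_Mapping.keys p" "b \<in> Poly_Mapping.keys q" "m = a + b" by blast
    then show ?thesis using that(1,2) Poly_Mapping.keys_add[of a b] by blast
  qed
  have add: "Poly_Mapping.keys m \<subseteq> V"
    if "\<forall>m \<in> Poly_Mapping.keys p. Poly_Mapping.keys m \<subseteq> V"
       "\<forall>m \<in> Poly_Mapping.keys q. Poly_Mapping.keys m \<subseteq> V"
       "m \<in> Poly_Mapping.keys (p + q)" for m and p q :: "('v, 'k) mpol"
    using that Poly_Mapping.keys_add[of p q] by blast
  show ?thesis
  proof (rule cringI)
    show "abelian_group (mpoly_ring V :: ('v, 'k) mpol ring)"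
    proof (rule abelian_groupI)
      fix x :: "('v, 'k) mpol" assume "x \<in> carrier (mpoly_ring V)"
      then have "- x \<in> carrier (mpoly_ring V)" by (simp add: mpoly_ring_def)
      then show "\<exists>y \<in> carrier (mpoly_ring V). y \<oplus>\<^bsub>mpoly_ring V\<^esub> x = \<zero>\<^bsub>mpoly_ring V\<^esub>"
        by (intro bexI[of _ "- x"]) (simp_all add: mpoly_ring_def)
    qed (auto simp: mpoly_ring_def algebra_simps dest: add)
    show "Group.comm_monoid (mpoly_ring V :: ('v, 'k) mpol ring)"
      by (rule comm_monoidI) (auto simp: mpoly_ring_def algebra_simps dest: mult)
  qed (auto simp: mpoly_ring_def algebra_simps)
qed

lemma module_quot_module:
  assumes "cring R" "ideal J R"
  shows "module R (quot_module R J)"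
proof -
  interpret cring R by fact
  interpret J: ideal J R by fact
  interpret Q: cring "R Quot J" by (rule J.quotient_is_cring[OF is_cring])
  interpret h: ring_hom_cring R "R Quot J" "a_r_coset R J"
    by (rule J.rcos_ring_hom_cring[OF is_cring])
  have ag: "abelian_group (quot_module R J)"
  proof (rule abelian_groupI)
    fix x assume "x \<in> carrier (quot_module R J)"
    then show "\<exists>y \<in> carrier (quot_module R J). y \<oplus>\<^bsub>quot_module R J\<^esub> x = \<zero>\<^bsub>quot_module R J\<^esub>"
      using Q.l_neg Q.a_inv_closed unfolding quot_module_def by fastforce
  qed (simp_all only: quot_module_def ring.simps monoid.simps partial_object.simps
        Q.a_closed Q.zero_closed Q.a_ac Q.l_zero Q.r_zero)
  show ?thesis
    by (rule moduleI[OF is_cring ag])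
       (simp_all only: quot_module_def module.simps ring.simps monoid.simps partial_object.simps
          h.hom_closed h.hom_add h.hom_mult h.hom_one Q.m_closed Q.l_distr Q.r_distr Q.m_assoc Q.l_one)
qed

lemma sqfree_monom_eq:
  assumes "finite \<sigma>"
  shows "(sqfree_monom \<sigma> :: ('v, 'k::field) mpol) = Poly_Mapping.single (\<Sum>v \<in> \<sigma>. Poly_Mapping.single v 1) 1"
  using assms unfolding sqfree_monom_def mvar_def
  by (induction rule: finite_induct) (simp_all add: mult_single)

lemma keys_sum_single:
  assumes "finite \<sigma>"
  shows "Poly_Mapping.keys (\<Sum>v \<in> \<sigma>. Poly_Mapping.single v (1::nat)) = \<sigma>"
proof -
  have "Poly_Mapping.lookup (\<Sum>v \<in> \<sigma>. Poly_Mapping.single v (1::nat)) w = (if w \<in> \<sigma> then 1 else 0)" for w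
    using assms by (simp add: lookup_sum lookup_single when_def sum.delta)
  then show ?thesis by (auto simp: in_keys_iff split: if_splits)
qed

lemma sqfree_monom_in_Idl:
  assumes "finite V" "A \<subseteq> Pow V" "\<sigma> \<subseteq> V"
    and mem: "(sqfree_monom \<sigma> :: ('v, 'k::field) mpol) \<in> Idl\<^bsub>mpoly_ring V\<^esub> (sqfree_monom ` A)"
  shows "\<exists>\<alpha> \<in> A. \<alpha> \<subseteq> \<sigma>"
proof -
  let ?R = "mpoly_ring V :: ('v, 'k) mpol ring"
  let ?I = "{p \<in> carrier ?R. \<forall>m \<in> Poly_Mapping.keys p. \<exists>\<alpha> \<in> A. \<alpha> \<subseteq> Poly_Mapping.keys m}"
  interpret cring ?R by (rule cring_mpoly_ring)
  have fin: "finite \<alpha>" if "\<alpha> \<subseteq> V" for \<alpha> using assms(1) that by (rule rev_finite_subset)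
  have kadd: "Poly_Mapping.keys (a + b) = Poly_Mapping.keys a \<union> Poly_Mapping.keys b"
    for a b :: "'v \<Rightarrow>\<^sub>0 nat"
    by (auto simp: in_keys_iff lookup_add)
  have kmult: "\<exists>\<alpha> \<in> A. \<alpha> \<subseteq> Poly_Mapping.keys m"
    if "p \<in> ?I" "m \<in> Poly_Mapping.keys (p * q)" for p q m
  proof -
    from that(2) keys_mult[of p q] obtain a b
      where ab: "a \<in> Poly_Mapping.keys p" "m = a + b" by blast
    with that(1) obtain \<alpha> where "\<alpha> \<in> A" "\<alpha> \<subseteq> Poly_Mapping.keys a" by blast
    then show ?thesis unfolding ab(2) kadd by blast
  qed
  have "ideal ?I ?R"
  proof (rule idealI)
    show "ring ?R" by (rule ring_axioms)
    show "subgroup ?I (add_monoid ?R)"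
    proof (rule add.subgroupI)
      show "?I \<subseteq> carrier ?R" by blast
      have "0 \<in> ?I" using zero_closed by (auto simp: mpoly_ring_def)
      then show "?I \<noteq> {}" by blast
      show "\<ominus>\<^bsub>?R\<^esub> a \<in> ?I" if "a \<in> ?I" for a
      proof -
        have c: "a \<in> carrier ?R" using that by blast
        have "a \<oplus>\<^bsub>?R\<^esub> \<ominus>\<^bsub>?R\<^esub> a = \<zero>\<^bsub>?R\<^esub>" by (rule r_neg[OF c])
        then have "a + \<ominus>\<^bsub>?R\<^esub> a = 0" by (simp add: mpoly_ring_def)
        then have "\<ominus>\<^bsub>?R\<^esub> a = - a" by (simp add: add_eq_0_iff)
        then show ?thesis using that a_inv_closed[OF c] by simp
      qed
      show "a \<oplus>\<^bsub>?R\<^esub> b \<in> ?I" if "a \<in> ?I" "b \<in> ?I" for a b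
      proof -
        have "a \<oplus>\<^bsub>?R\<^esub> b \<in> carrier ?R" using that by (intro a_closed) auto
        moreover have "\<exists>\<alpha> \<in> A. \<alpha> \<subseteq> Poly_Mapping.keys m" if m: "m \<in> Poly_Mapping.keys (a + b)" for m
          using m \<open>a \<in> ?I\<close> \<open>b \<in> ?I\<close> Poly_Mapping.keys_add[of a b] by blast
        ultimately show ?thesis by (auto simp: mpoly_ring_def)
      qed
    qed
    show "x \<otimes>\<^bsub>?R\<^esub> a \<in> ?I" "a \<otimes>\<^bsub>?R\<^esub> x \<in> ?I" if "a \<in> ?I" "x \<in> carrier ?R" for a x
    proof -
      have c: "a \<otimes>\<^bsub>?R\<^esub> x \<in> carrier ?R" using that by (intro m_closed) auto
      then show 1: "a \<otimes>\<^bsub>?R\<^esub> x \<in> ?I"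
        using kmult[OF that(1), of _ x] by (simp add: mpoly_ring_def)
      have "x \<otimes>\<^bsub>?R\<^esub> a = a \<otimes>\<^bsub>?R\<^esub> x" using that by (intro m_comm) auto
      with 1 show "x \<otimes>\<^bsub>?R\<^esub> a \<in> ?I" by simp
    qed
  qed
  moreover have "sqfree_monom \<alpha> \<in> ?I" if "\<alpha> \<in> A" for \<alpha>
  proof -
    have "\<alpha> \<subseteq> V" "finite \<alpha>" using that assms(2) fin by auto
    then show ?thesis
      using that by (auto simp: sqfree_monom_eq mpoly_ring_def keys_sum_single simp del: One_nat_def)
  qed
  then have "sqfree_monom ` A \<subseteq> ?I" by (rule image_subsetI)
  ultimately have "(sqfree_monom \<sigma> :: ('v, 'k) mpol) \<in> ?I"
    using genideal_minimal[of ?I "sqfree_monom ` A"] mem by (meson subsetD)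
  then show ?thesis
    using fin[OF assms(3)] by (simp add: sqfree_monom_eq keys_sum_single del: One_nat_def)
qed

lemma sqfree_monom_closed:
  assumes "finite V" "\<sigma> \<subseteq> V"
  shows "sqfree_monom \<sigma> \<in> carrier (mpoly_ring V :: ('v, 'k::field) mpol ring)"
  using assms finite_subset[OF assms(2,1)]
  by (auto simp: sqfree_monom_eq mpoly_ring_def keys_sum_single simp del: One_nat_def)

lemma alexander_dual_Idl:
  assumes "finite V" "A \<subseteq> Pow V"
  shows "alexander_dual V (Idl\<^bsub>mpoly_ring V\<^esub> (sqfree_monom ` A) :: ('v, 'k::field) mpol set) =
    Idl\<^bsub>mpoly_ring V\<^esub> (sqfree_monom ` {\<tau>. \<tau> \<subseteq> V \<and> (\<forall>\<sigma> \<in> A. \<tau> \<inter> \<sigma> \<noteq> {})})"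
  unfolding alexander_dual_def
proof (rule the_equality, goal_cases)
  case 1
  then show ?case using assms(2) by blast
next
  case (2 D)
  let ?R = "mpoly_ring V :: ('v, 'k) mpol ring"
  interpret cring ?R by (rule cring_mpoly_ring)
  from 2 obtain B where B: "B \<subseteq> Pow V"
    "Idl\<^bsub>?R\<^esub> (sqfree_monom ` A) = Idl\<^bsub>?R\<^esub> (sqfree_monom ` B)"
    "D = Idl\<^bsub>?R\<^esub> (sqfree_monom ` {\<tau>. \<tau> \<subseteq> V \<and> (\<forall>\<sigma> \<in> B. \<tau> \<inter> \<sigma> \<noteq> {})})" by blast
  have sub: "sqfree_monom ` C \<subseteq> Idl\<^bsub>?R\<^esub> (sqfree_monom ` C)" if "C \<subseteq> Pow V" for C
    using that assms(1) by (intro genideal_self) (auto intro!: sqfree_monom_closed)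
  have 1: "\<exists>\<alpha> \<in> A. \<alpha> \<subseteq> \<beta>" if "\<beta> \<in> B" for \<beta>
    using that sub[OF B(1)] B(1,2) by (intro sqfree_monom_in_Idl[OF assms]) auto
  have 2: "\<exists>\<beta> \<in> B. \<beta> \<subseteq> \<alpha>" if "\<alpha> \<in> A" for \<alpha>
    using that sub[OF assms(2)] assms(2) B(2)
    by (intro sqfree_monom_in_Idl[OF assms(1) B(1)]) auto
  have "(\<forall>\<sigma> \<in> A. \<tau> \<inter> \<sigma> \<noteq> {}) \<longleftrightarrow> (\<forall>\<sigma> \<in> B. \<tau> \<inter> \<sigma> \<noteq> {})" for \<tau>
  proof (intro iffI ballI)
    fix \<beta> assume h: "\<forall>\<sigma> \<in> A. \<tau> \<inter> \<sigma> \<noteq> {}" and "\<beta> \<in> B"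
    from 1[OF this(2)] obtain \<alpha> where "\<alpha> \<in> A" "\<alpha> \<subseteq> \<beta>" by (elim bexE)
    with h show "\<tau> \<inter> \<beta> \<noteq> {}" by auto
  next
    fix \<alpha> assume h: "\<forall>\<sigma> \<in> B. \<tau> \<inter> \<sigma> \<noteq> {}" and "\<alpha> \<in> A"
    from 2[OF this(2)] obtain \<beta> where "\<beta> \<in> B" "\<beta> \<subseteq> \<alpha>" by (elim bexE)
    with h show "\<tau> \<inter> \<alpha> \<noteq> {}" by auto
  qed
  then show ?case using B(3) by simp
qed

end

theory Submission
  imports Defs
begin

text \<open>
  Every ideal that occurs while the differences \<open>x\<^sub>i\<^bsup>(1)\<^esup> - x\<^sub>i\<^bsup>(j)\<^esup>\<close> are divided out one at a time is
  a square-free monomial ideal, because each generator contains at most one variable over each \<open>i\<close>.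
  It is therefore given by an up-closed family \<open>U\<close> of sets of variables, and \<open>x - y\<close> is a
  non-zero-divisor modulo it iff \<open>M \<union> {x} \<in> U\<close> and \<open>M \<union> {y} \<in> U\<close> imply \<open>M \<in> U\<close>, that is, iff no
  minimal generator of the Alexander dual contains both \<open>x\<close> and \<open>y\<close>.  Identifying variables commutes
  with Alexander duality.  So the fact that the generators of the given ideal never contain both \<open>x\<close>
  and \<open>y\<close> makes the sequence regular modulo the dual.  Conversely, regularity modulo the given ideal
  forces the minimal generators of the dual to contain at most one variable over each \<open>i\<close>; such a
  generator over \<open>\<tau>\<close> meets, for each \<open>i \<in> \<tau>\<close>, the generator over the complement of \<open>\<tau> - {i}\<close> exactly
  in its variable over \<open>i\<close>, which determines the dual partitioning.
\<close>

section \<open>Relabelling of variables\<close>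

lemma poly_mapping_sum_keys:
  assumes "finite K" "Poly_Mapping.keys p \<subseteq> K"
  shows "p = (\<Sum>m \<in> K. Poly_Mapping.single m (Poly_Mapping.lookup p m))"
proof (rule poly_mapping_eqI)
  fix m show "Poly_Mapping.lookup p m = Poly_Mapping.lookup (\<Sum>m \<in> K. Poly_Mapping.single m (Poly_Mapping.lookup p m)) m"
    using assms by (auto simp: lookup_sum lookup_single when_def sum.delta' in_keys_iff)
qed

lemma mvar_mult_eq: "mvar v * p = (\<Sum>m \<in> Poly_Mapping.keys p. Poly_Mapping.single (Poly_Mapping.single v 1 + m) (Poly_Mapping.lookup p m))"
  by (subst (1) poly_mapping_sum_keys[OF finite_keys order_refl, of p])
    (simp add: mvar_def sum_distrib_left mult_single)

lemma lookup_mvar_mult: "Poly_Mapping.lookup (mvar v * p) (Poly_Mapping.single v 1 + m) = Poly_Mapping.lookup p m"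
  by (simp add: mvar_mult_eq lookup_sum lookup_single when_def sum.delta in_keys_iff)

lemma keys_mvar_mult: "Poly_Mapping.keys (mvar v * p) = (+) (Poly_Mapping.single v 1) ` Poly_Mapping.keys p"
proof -
  have "m \<in> (+) (Poly_Mapping.single v 1) ` Poly_Mapping.keys p" if "m \<in> Poly_Mapping.keys (mvar v * p)" for m
    using that keys_mult[of "mvar v" p] by (auto simp: mvar_def)
  moreover have "Poly_Mapping.single v 1 + m \<in> Poly_Mapping.keys (mvar v * p)" if "m \<in> Poly_Mapping.keys p" for m
    using that by (metis lookup_mvar_mult in_keys_iff)
  ultimately show ?thesis by auto
qed

lemma keys_add_nat: "Poly_Mapping.keys (a + b) = Poly_Mapping.keys a \<union> Poly_Mapping.keys (b :: 'v \<Rightarrow>\<^sub>0 nat)"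
  by (auto simp: in_keys_iff lookup_add)

text \<open>Every exponent vector arises from 0 by multiplying by one variable at a time, so
  identities about monomials reduce to the effect of a single variable.\<close>

lemma poly_mapping_nat_induct [case_names zero add]:
  fixes m :: "'v \<Rightarrow>\<^sub>0 nat"
  assumes "Q 0" "\<And>v m. Q m \<Longrightarrow> Q (Poly_Mapping.single v 1 + m)"
  shows "Q m"
proof -
  have s: "Q (Poly_Mapping.single v k + m)" if "Q m" for v k m
  proof (induction k)
    case (Suc k)
    have "Poly_Mapping.single v (Suc k) + m = Poly_Mapping.single v 1 + (Poly_Mapping.single v k + m)"
      by (simp add: add.assoc[symmetric] single_add[symmetric])
    then show ?case using assms(2)[OF Suc] by simp
  qed (simp add: that)
  have "Q (\<Sum>v \<in> K. Poly_Mapping.single v (Poly_Mapping.lookup m v))" if "finite K" for K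
    using that by (induction K) (simp_all add: assms(1) s)
  from this[of "Poly_Mapping.keys m"] show ?thesis
    using poly_mapping_sum_keys[OF finite_keys order_refl, of m] by simp
qed

text \<open>Substitution of variables for variables. Both \<open>depol\<close> (with
  \<open>fst\<close>) and the partial identifications of variables (with \<open>merge\<close>) are
  instances.\<close>

definition relab :: "('v \<Rightarrow> 'w) \<Rightarrow> ('v, 'k::comm_ring_1) mpol \<Rightarrow> ('w, 'k) mpol" where
  "relab f = msubst (\<lambda>v. mvar (f v))"

text \<open>The effect of \<open>relab f\<close> on exponent vectors: exponents of variables with
  the same image under \<open>f\<close> are added.\<close>

definition push :: "('v \<Rightarrow> 'w) \<Rightarrow> ('v \<Rightarrow>\<^sub>0 nat) \<Rightarrow> ('w \<Rightarrow>\<^sub>0 nat)" where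
  "push f m = (\<Sum>v \<in> Poly_Mapping.keys m. Poly_Mapping.single (f v) (Poly_Mapping.lookup m v))"

lemma mvar_power: "mvar v ^ e = Poly_Mapping.single (Poly_Mapping.single v e) 1"
  by (induction e) (simp_all add: mvar_def mult_single single_add[symmetric])

lemma prod_single: "finite K \<Longrightarrow> (\<Prod>v \<in> K. Poly_Mapping.single (h v) (1 :: 'k::comm_ring_1)) = Poly_Mapping.single (\<Sum>v \<in> K. h v :: 'w \<Rightarrow>\<^sub>0 nat) 1"
  by (induction K rule: finite_induct) (simp_all add: mult_single)

lemma relab_eq:
  assumes "finite K" "Poly_Mapping.keys p \<subseteq> K"
  shows "relab f p = (\<Sum>m \<in> K. Poly_Mapping.single (push f m) (Poly_Mapping.lookup p m))"
proof -
  have "relab f p = (\<Sum>m \<in> Poly_Mapping.keys p. Poly_Mapping.single (push f m) (Poly_Mapping.lookup p m))"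
    unfolding relab_def msubst_def push_def
    by (simp add: mvar_power prod_single mconst_def mult_single)
  also have "\<dots> = (\<Sum>m \<in> K. Poly_Mapping.single (push f m) (Poly_Mapping.lookup p m))"
    using assms by (intro sum.mono_neutral_left) (auto simp: in_keys_iff)
  finally show ?thesis .
qed

lemma relab_add: "relab f (p + q) = relab f p + relab f q"
  using Poly_Mapping.keys_add[of p q]
  by (simp add: relab_eq[of "Poly_Mapping.keys p \<union> Poly_Mapping.keys q"] lookup_add single_add sum.distrib)

lemma relab_single: "relab f (Poly_Mapping.single m c) = Poly_Mapping.single (push f m) c"
  by (subst relab_eq[of "{m}"]) auto

lemma relab_0 [simp]: "relab f 0 = 0"
  by (subst relab_eq[of "{}"]) auto

lemma relab_sum: "relab f (\<Sum>i \<in> I. g i) = (\<Sum>i \<in> I. relab f (g i))"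
  by (induction I rule: infinite_finite_induct) (simp_all add: relab_add)

lemma relab_diff: "relab f (p - q) = relab f p - relab f q"
  using relab_add[of f "p - q" q] by (simp add: algebra_simps)

lemma push_eq:
  assumes "finite K" "Poly_Mapping.keys m \<subseteq> K"
  shows "push f m = (\<Sum>v \<in> K. Poly_Mapping.single (f v) (Poly_Mapping.lookup m v))"
  unfolding push_def using assms by (intro sum.mono_neutral_left) (auto simp: in_keys_iff)

lemma push_add: "push f (a + b) = push f a + push f b"
  by (simp add: push_eq[of "Poly_Mapping.keys a \<union> Poly_Mapping.keys b"] keys_add_nat lookup_add single_add sum.distrib)

lemma push_single: "push f (Poly_Mapping.single v e) = Poly_Mapping.single (f v) e"
  by (subst push_eq[of "{v}"]) auto

lemma push_0 [simp]: "push f 0 = 0"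
  by (simp add: push_def)

lemma keys_push: "Poly_Mapping.keys (push f m) = f ` Poly_Mapping.keys m"
  by (induction m rule: poly_mapping_nat_induct) (simp_all add: push_add push_single keys_add_nat)

lemma push_push: "push g (push f m) = push (\<lambda>v. g (f v)) m"
  by (induction m rule: poly_mapping_nat_induct) (simp_all add: push_add push_single)

lemma relab_relab: "relab g (relab f p) = relab (\<lambda>v. g (f v)) p"
  by (simp add: relab_eq[OF finite_keys order_refl, of f] relab_eq[OF finite_keys order_refl, of "\<lambda>v. g (f v)"]
      relab_sum relab_single push_push)

lemma relab_mvar_mult: "relab f (mvar v * p) = mvar (f v) * relab f p"
proof -
  have "relab f (mvar v * p) = (\<Sum>m \<in> Poly_Mapping.keys p.
      Poly_Mapping.single (push f (Poly_Mapping.single v 1 + m)) (Poly_Mapping.lookup p m))"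
    by (simp only: mvar_mult_eq[of v p] relab_sum relab_single)
  also have "\<dots> = mvar (f v) * relab f p"
    by (simp add: relab_eq[OF finite_keys order_refl, of f p] sum_distrib_left push_add push_single
        mvar_def mult_single)
  finally show ?thesis .
qed

text \<open>Only an inclusion, because distinct monomials with the same image may cancel.\<close>

lemma keys_relab: "Poly_Mapping.keys (relab f p) \<subseteq> push f ` Poly_Mapping.keys p"
  unfolding relab_eq[OF finite_keys order_refl, of f p]
  by (rule order_trans[OF keys_sum]) auto

lemma depol_eq_relab: "depol = relab fst"
  unfolding depol_def relab_def by (simp add: case_prod_beta')

section \<open>Ideals of the polynomial ring in terms of the ordinary operations\<close>

lemma mem_carrier_mpoly_ring:
  "p \<in> carrier (mpoly_ring V) \<longleftrightarrow> (\<forall>m \<in> Poly_Mapping.keys p. Poly_Mapping.keys m \<subseteq> V)"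
  by (simp add: mpoly_ring_def)

lemma mpoly_ring_simps [simp]:
  "x \<otimes>\<^bsub>mpoly_ring V\<^esub> y = x * y" "x \<oplus>\<^bsub>mpoly_ring V\<^esub> y = x + y"
  "\<one>\<^bsub>mpoly_ring V\<^esub> = 1" "\<zero>\<^bsub>mpoly_ring V\<^esub> = 0"
  by (simp_all add: mpoly_ring_def)

lemma mvar_closed: "v \<in> V \<Longrightarrow> mvar v \<in> carrier (mpoly_ring V)"
  by (simp add: mem_carrier_mpoly_ring mvar_def)

lemma single_closed: "Poly_Mapping.keys m \<subseteq> V \<Longrightarrow> Poly_Mapping.single m c \<in> carrier (mpoly_ring V)"
  by (simp add: mem_carrier_mpoly_ring)

context
  fixes V :: "'v set" and I :: "('v, 'k::comm_ring_1) mpol set"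
  assumes I: "ideal I (mpoly_ring V)"
begin

interpretation ideal I "mpoly_ring V" by (rule I)

lemma mpoly_ideal_carrier: "p \<in> I \<Longrightarrow> p \<in> carrier (mpoly_ring V)"
  by (rule Icarr)

lemma mpoly_ideal_0: "0 \<in> I"
  using additive_subgroup.zero_closed[OF is_additive_subgroup] by simp

lemma mpoly_ideal_add: "p \<in> I \<Longrightarrow> q \<in> I \<Longrightarrow> p + q \<in> I"
  using additive_subgroup.a_closed[OF is_additive_subgroup, of p q] by simp

lemma mpoly_ideal_mult: "p \<in> I \<Longrightarrow> q \<in> carrier (mpoly_ring V) \<Longrightarrow> q * p \<in> I"
  using I_l_closed[of p q] by simp

lemma mpoly_ideal_diff: "p \<in> I \<Longrightarrow> q \<in> I \<Longrightarrow> p - q \<in> I"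
  using mpoly_ideal_add[of p "- 1 * q"] mpoly_ideal_mult[of q "- 1"]
  by (simp add: mem_carrier_mpoly_ring)

lemma mpoly_ideal_sum: "(\<And>i. i \<in> K \<Longrightarrow> g i \<in> I) \<Longrightarrow> (\<Sum>i \<in> K. g i) \<in> I"
  by (induction K rule: infinite_finite_induct) (auto intro: mpoly_ideal_0 mpoly_ideal_add)

end

text \<open>As the unit ideal, the carrier inherits its closure rules from those for ideals.\<close>

lemma ideal_carrier_mpoly_ring:
  "ideal (carrier (mpoly_ring V :: ('v, 'k::comm_ring_1) mpol ring)) (mpoly_ring V)"
proof -
  interpret cring "mpoly_ring V :: ('v, 'k) mpol ring" by (rule cring_mpoly_ring)
  show ?thesis by (rule oneideal)
qed

lemmas mpoly_add_closed = mpoly_ideal_add[OF ideal_carrier_mpoly_ring]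
lemmas mpoly_diff_closed = mpoly_ideal_diff[OF ideal_carrier_mpoly_ring]
lemmas mpoly_mult_closed = mpoly_ideal_mult[OF ideal_carrier_mpoly_ring]
lemmas mpoly_sum_closed = mpoly_ideal_sum[OF ideal_carrier_mpoly_ring]

lemma mpoly_idealI:
  fixes I :: "('v, 'k::comm_ring_1) mpol set"
  assumes "I \<subseteq> carrier (mpoly_ring V)" "0 \<in> I" "\<And>p q. p \<in> I \<Longrightarrow> q \<in> I \<Longrightarrow> p + q \<in> I"
    "\<And>p q. p \<in> I \<Longrightarrow> q \<in> carrier (mpoly_ring V) \<Longrightarrow> q * p \<in> I"
  shows "ideal I (mpoly_ring V)"
proof -
  let ?R = "mpoly_ring V :: ('v, 'k) mpol ring"
  interpret cring ?R by (rule cring_mpoly_ring)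
  have neg: "\<ominus>\<^bsub>?R\<^esub> p = - 1 * p" if "p \<in> carrier ?R" for p
    using r_neg[OF that] by (simp add: add_eq_0_iff)
  have m1: "- 1 \<in> carrier ?R" by (simp add: mem_carrier_mpoly_ring)
  show ?thesis
  proof (rule idealI)
    show "subgroup I (add_monoid ?R)"
    proof (rule add.subgroupI)
      show "\<ominus>\<^bsub>?R\<^esub> p \<in> I" if "p \<in> I" for p
        using neg[of p] assms(1) assms(4)[OF that m1] that by auto
    qed (use assms in auto)
  qed (use assms ring_axioms in \<open>auto simp: mult.commute\<close>)
qed

section \<open>Square-free monomial ideals\<close>

definition upset :: "'v set \<Rightarrow> 'v set set \<Rightarrow> bool" where
  "upset V U \<longleftrightarrow> U \<subseteq> Pow V \<and> (\<forall>M \<in> U. \<forall>N. M \<subseteq> N \<and> N \<subseteq> V \<longrightarrow> N \<in> U)"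

definition up_closure :: "'v set \<Rightarrow> 'v set set \<Rightarrow> 'v set set" where
  "up_closure V A = {M. M \<subseteq> V \<and> (\<exists>\<alpha> \<in> A. \<alpha> \<subseteq> M)}"

lemma upsetD: "upset V U \<Longrightarrow> M \<in> U \<Longrightarrow> M \<subseteq> N \<Longrightarrow> N \<subseteq> V \<Longrightarrow> N \<in> U"
  by (auto simp: upset_def)

lemma upset_subset: "upset V U \<Longrightarrow> M \<in> U \<Longrightarrow> M \<subseteq> V"
  by (auto simp: upset_def)

lemma upset_up_closure: "upset V (up_closure V A)"
  by (auto simp: upset_def up_closure_def)

text \<open>Membership depends only on the supports of the monomials and not on their exponents,
  which is what square-freeness of a monomial ideal means. For an up-closed \<open>U\<close> this is
  an ideal.\<close>

definition support_ideal :: "'v set \<Rightarrow> 'v set set \<Rightarrow> ('v, 'k::comm_ring_1) mpol set" where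
  "support_ideal V U = {p \<in> carrier (mpoly_ring V). \<forall>m \<in> Poly_Mapping.keys p. Poly_Mapping.keys m \<in> U}"

lemma support_ideal_iff:
  "upset V U \<Longrightarrow> p \<in> support_ideal V U \<longleftrightarrow> (\<forall>m \<in> Poly_Mapping.keys p. Poly_Mapping.keys m \<in> U)"
  by (auto simp: support_ideal_def mem_carrier_mpoly_ring upset_def)

lemma ideal_support_ideal:
  assumes "upset V U"
  shows "ideal (support_ideal V U :: ('v, 'k::comm_ring_1) mpol set) (mpoly_ring V)"
proof (rule mpoly_idealI)
  show "p + q \<in> support_ideal V U" if "p \<in> support_ideal V U" "q \<in> support_ideal V U"
    for p q :: "('v, 'k) mpol"
    using that Poly_Mapping.keys_add[of p q] by (auto simp: support_ideal_iff[OF assms])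
  show "q * p \<in> support_ideal V U" if p: "p \<in> support_ideal V U" and q: "q \<in> carrier (mpoly_ring V)"
    for p q :: "('v, 'k) mpol"
    unfolding support_ideal_iff[OF assms]
  proof
    fix m assume "m \<in> Poly_Mapping.keys (q * p)"
    with keys_mult[of q p] obtain a b
      where ab: "a \<in> Poly_Mapping.keys q" "b \<in> Poly_Mapping.keys p" "m = a + b" by blast
    then have "Poly_Mapping.keys b \<in> U" using p by (auto simp: support_ideal_iff[OF assms])
    moreover have "Poly_Mapping.keys a \<subseteq> V" using q ab by (auto simp: mem_carrier_mpoly_ring)
    ultimately show "Poly_Mapping.keys m \<in> U"
      using upsetD[OF assms] upset_subset[OF assms] by (simp add: ab(3) keys_add_nat)
  qed
qed (auto simp: support_ideal_def mem_carrier_mpoly_ring)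

lemma single_in_support_ideal:
  "upset V U \<Longrightarrow> Poly_Mapping.keys m \<in> U \<Longrightarrow> Poly_Mapping.single m c \<in> support_ideal V U"
  by (simp add: support_ideal_iff)

text \<open>A monomial whose support contains \<open>\<alpha>\<close> is a multiple of the
  square-free monomial of \<open>\<alpha>\<close>, and the support ideal is an ideal that contains
  the generators. From here on ideals are replaced by up-closed families of sets.\<close>

lemma Idl_sqfree_monom:
  assumes "finite V" "A \<subseteq> Pow V"
  shows "Idl\<^bsub>mpoly_ring V\<^esub> (sqfree_monom ` A) = (support_ideal V (up_closure V A) :: ('v, 'k::field) mpol set)"
proof
  let ?R = "mpoly_ring V :: ('v, 'k) mpol ring"
  let ?I = "Idl\<^bsub>?R\<^esub> (sqfree_monom ` A)"
  interpret cring ?R by (rule cring_mpoly_ring)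
  have fin: "finite \<alpha>" if "\<alpha> \<in> A" for \<alpha> using that assms by (meson PowD finite_subset subsetD)
  have cl: "sqfree_monom ` A \<subseteq> carrier ?R"
    using sqfree_monom_closed[OF assms(1)] assms(2) by auto
  have I: "ideal ?I ?R" by (rule genideal_ideal[OF cl])
  have mem: "(sqfree_monom \<alpha> :: ('v, 'k) mpol) \<in> support_ideal V (up_closure V A)" if "\<alpha> \<in> A" for \<alpha>
  proof -
    have "\<alpha> \<subseteq> V" using that assms(2) by blast
    with that have "\<alpha> \<in> up_closure V A" by (auto simp: up_closure_def)
    then show ?thesis
      using fin[OF that] by (simp add: sqfree_monom_eq single_in_support_ideal[OF upset_up_closure]
          keys_sum_single del: One_nat_def)
  qed
  show "?I \<subseteq> support_ideal V (up_closure V A)"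
    using mem by (intro genideal_minimal ideal_support_ideal upset_up_closure) blast
  show "support_ideal V (up_closure V A) \<subseteq> ?I"
  proof
    fix p :: "('v, 'k) mpol" assume p: "p \<in> support_ideal V (up_closure V A)"
    have "Poly_Mapping.single m c \<in> ?I" if "m \<in> Poly_Mapping.keys p" for m c
    proof -
      have "Poly_Mapping.keys m \<in> up_closure V A" using that p by (auto simp: support_ideal_def)
      then obtain \<alpha> where \<alpha>: "\<alpha> \<in> A" "\<alpha> \<subseteq> Poly_Mapping.keys m" and mV: "Poly_Mapping.keys m \<subseteq> V"
        by (auto simp: up_closure_def)
      let ?s = "\<Sum>v \<in> \<alpha>. Poly_Mapping.single v (1::nat)"
      have lk: "Poly_Mapping.lookup ?s w = (if w \<in> \<alpha> then 1 else 0)" for w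
        using fin[OF \<alpha>(1)] by (simp add: lookup_sum lookup_single when_def sum.delta)
      \<comment> \<open>Truncated subtraction loses nothing: each variable of
        \<open>\<alpha>\<close> has exponent at least 1 in \<open>m\<close>.\<close>
      have m: "m = (m - ?s) + ?s"
        using \<alpha>(2) by (intro poly_mapping_eqI) (auto simp: lookup_add lookup_minus lk in_keys_iff simp del: One_nat_def)
      have sub: "Poly_Mapping.keys (m - ?s) \<subseteq> V"
        using mV by (auto simp: in_keys_iff lookup_minus)
      have "Poly_Mapping.single (m - ?s) c * sqfree_monom \<alpha> \<in> ?I"
        using genideal_self[OF cl] \<alpha>(1) by (intro mpoly_ideal_mult[OF I] single_closed sub) auto
      also have "Poly_Mapping.single (m - ?s) c * sqfree_monom \<alpha> = Poly_Mapping.single m c"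
        by (subst (2) m) (simp only: sqfree_monom_eq[OF fin[OF \<alpha>(1)]] mult_single mult_1_right)
      finally show ?thesis .
    qed
    then show "p \<in> ?I"
      by (subst poly_mapping_sum_keys[OF finite_keys order_refl]) (intro mpoly_ideal_sum[OF I])
  qed
qed

section \<open>Regular sequences in polynomial rings\<close>

text \<open>The ideal generated by \<open>fs\<close>, written with one coefficient per position as
  in \<open>seq_times_module\<close>; this suits inductions over prefixes of the sequence.\<close>

definition seq_span :: "'v set \<Rightarrow> ('v, 'k::comm_ring_1) mpol list \<Rightarrow> ('v, 'k) mpol set" where
  "seq_span V fs = {\<Sum>i<length fs. fs ! i * c i | c. c \<in> {..<length fs} \<rightarrow> carrier (mpoly_ring V)}"

lemma seq_span_Nil [simp]: "seq_span V [] = {0}"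
  by (auto simp: seq_span_def)

lemma seq_span_snoc: "seq_span V (fs @ [f]) = {q + f * c | q c. q \<in> seq_span V fs \<and> c \<in> carrier (mpoly_ring V)}"
  (is "?L = ?R")
proof
  show "?L \<subseteq> ?R"
  proof
    fix p assume "p \<in> ?L"
    then obtain c where c: "c \<in> {..<Suc (length fs)} \<rightarrow> carrier (mpoly_ring V)"
      "p = (\<Sum>i<Suc (length fs). (fs @ [f]) ! i * c i)" by (auto simp: seq_span_def)
    then have "p = (\<Sum>i<length fs. fs ! i * c i) + f * c (length fs)"
      by (auto simp: nth_append)
    moreover have "(\<Sum>i<length fs. fs ! i * c i) \<in> seq_span V fs"
      unfolding seq_span_def using c(1) by (intro CollectI exI[of _ c]) auto
    moreover have "c (length fs) \<in> carrier (mpoly_ring V)" using c(1) by auto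
    ultimately show "p \<in> ?R" by blast
  qed
  show "?R \<subseteq> ?L"
  proof
    fix p assume "p \<in> ?R"
    then obtain c e where c: "c \<in> {..<length fs} \<rightarrow> carrier (mpoly_ring V)" "e \<in> carrier (mpoly_ring V)"
      "p = (\<Sum>i<length fs. fs ! i * c i) + f * e" by (auto simp: seq_span_def)
    let ?c = "c(length fs := e)"
    have "p = (\<Sum>i<length (fs @ [f]). (fs @ [f]) ! i * ?c i)"
      using c(3) by (auto simp: nth_append)
    moreover have "?c \<in> {..<length (fs @ [f])} \<rightarrow> carrier (mpoly_ring V)"
      using c(1,2) by (auto simp: less_Suc_eq)
    ultimately show "p \<in> ?L" unfolding seq_span_def by blast
  qed
qed

lemma Idl_set_eq_seq_span:
  fixes fs :: "('v, 'k::comm_ring_1) mpol list"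
  assumes "set fs \<subseteq> carrier (mpoly_ring V)"
  shows "Idl\<^bsub>mpoly_ring V\<^esub> (set fs) = seq_span V fs" and "ideal (seq_span V fs) (mpoly_ring V)"
proof -
  let ?R = "mpoly_ring V :: ('v, 'k) mpol ring"
  interpret cring ?R by (rule cring_mpoly_ring)
  have nth: "fs ! i \<in> carrier ?R" if "i < length fs" for i using that assms by auto
  show I: "ideal (seq_span V fs) ?R"
  proof (rule mpoly_idealI)
    show "seq_span V fs \<subseteq> carrier ?R"
      by (auto simp: seq_span_def mult.commute[of "fs ! _"] intro!: mpoly_sum_closed mpoly_mult_closed nth)
    show "0 \<in> seq_span V fs"
      unfolding seq_span_def by (rule CollectI, rule exI[of _ "\<lambda>_. 0"]) (simp add: mem_carrier_mpoly_ring)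
  next
    fix p q assume "p \<in> seq_span V fs" "q \<in> seq_span V fs"
    then obtain c e where "c \<in> {..<length fs} \<rightarrow> carrier ?R" "e \<in> {..<length fs} \<rightarrow> carrier ?R"
      "p = (\<Sum>i<length fs. fs ! i * c i)" "q = (\<Sum>i<length fs. fs ! i * e i)"
      by (auto simp: seq_span_def)
    then show "p + q \<in> seq_span V fs" unfolding seq_span_def
      by (intro CollectI exI[of _ "\<lambda>i. c i + e i"]) (auto simp: algebra_simps sum.distrib intro!: mpoly_add_closed)
  next
    fix p q assume "p \<in> seq_span V fs" and q: "q \<in> carrier ?R"
    then obtain c where "c \<in> {..<length fs} \<rightarrow> carrier ?R"
      "p = (\<Sum>i<length fs. fs ! i * c i)" by (auto simp: seq_span_def)
    with q show "q * p \<in> seq_span V fs" unfolding seq_span_def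
      by (intro CollectI exI[of _ "\<lambda>i. q * c i"]) (auto simp: algebra_simps sum_distrib_left intro!: mpoly_mult_closed)
  qed
  show "Idl\<^bsub>?R\<^esub> (set fs) = seq_span V fs"
  proof
    have "f \<in> seq_span V fs" if f: "f \<in> set fs" for f
    proof -
      obtain j where j: "j < length fs" "f = fs ! j" using f by (auto simp: in_set_conv_nth)
      have "f = (\<Sum>i<length fs. fs ! i * (if i = j then 1 else 0))"
        using j by (simp add: if_distrib[of "(*) _"] sum.delta cong: if_cong)
      moreover have "(\<lambda>i. if i = j then 1 else 0) \<in> {..<length fs} \<rightarrow> carrier ?R"
        by (auto simp: mem_carrier_mpoly_ring)
      ultimately show ?thesis unfolding seq_span_def
        by (intro CollectI exI[of _ "\<lambda>i. if i = j then 1 else 0"] conjI)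
    qed
    then show "Idl\<^bsub>?R\<^esub> (set fs) \<subseteq> seq_span V fs" by (intro genideal_minimal I) blast
    show "seq_span V fs \<subseteq> Idl\<^bsub>?R\<^esub> (set fs)"
    proof -
      have J: "ideal (Idl\<^bsub>?R\<^esub> (set fs)) ?R" by (rule genideal_ideal[OF assms])
      have "fs ! i * c i \<in> Idl\<^bsub>?R\<^esub> (set fs)" if "i < length fs" "c \<in> {..<length fs} \<rightarrow> carrier ?R" for i c
        using mpoly_ideal_mult[OF J, of "fs ! i" "c i"] genideal_self[OF assms] nth_mem[OF that(1)] that
        by (auto simp: mult.commute subset_iff Pi_iff)
      then show ?thesis by (auto simp: seq_span_def intro!: mpoly_ideal_sum[OF J])
    qed
  qed
qed

lemma finsum_mpoly_ring:
  assumes "finite K" "g \<in> K \<rightarrow> carrier (mpoly_ring V)"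
  shows "finsum (mpoly_ring V) g K = (\<Sum>i \<in> K. g i :: ('v, 'k::comm_ring_1) mpol)"
proof -
  interpret cring "mpoly_ring V :: ('v, 'k) mpol ring" by (rule cring_mpoly_ring)
  show ?thesis using assms by (induction K rule: finite_induct) auto
qed

text \<open>The coset of \<open>a\<close> lies in \<open>(fs)(R/J)\<close> iff \<open>a\<close> lies
  in \<open>J + (fs)\<close>: coefficients in \<open>R/J\<close> have representatives in
  \<open>R\<close>, and the coset map is a ring homomorphism.\<close>

lemma mem_seq_times_quot_module:
  fixes J :: "('v, 'k::comm_ring_1) mpol set"
  assumes J: "ideal J (mpoly_ring V)" and fs: "set fs \<subseteq> carrier (mpoly_ring V)"
    and a: "a \<in> carrier (mpoly_ring V)"
  shows "J +>\<^bsub>mpoly_ring V\<^esub> a \<in> seq_times_module (mpoly_ring V) (quot_module (mpoly_ring V) J) fs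
    \<longleftrightarrow> (\<exists>q \<in> seq_span V fs. a - q \<in> J)"
proof -
  let ?R = "mpoly_ring V :: ('v, 'k) mpol ring"
  let ?M = "quot_module ?R J"
  interpret cring ?R by (rule cring_mpoly_ring)
  interpret J: ideal J ?R by fact
  interpret Q: cring "?R Quot J" by (rule J.quotient_is_cring[OF is_cring])
  interpret h: ring_hom_cring ?R "?R Quot J" "a_r_coset ?R J"
    by (rule J.rcos_ring_hom_cring[OF is_cring])
  have nth: "fs ! i \<in> carrier ?R" if "i < length fs" for i using that fs by auto
  have eq: "J +>\<^bsub>?R\<^esub> a = J +>\<^bsub>?R\<^esub> q \<longleftrightarrow> a - q \<in> J" if q: "q \<in> carrier ?R" for q
  proof -
    have "a \<ominus>\<^bsub>?R\<^esub> q = a - q"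
      using r_neg[OF q] by (simp add: a_minus_def add_eq_0_iff)
    then show ?thesis using quotient_eq_iff_same_a_r_cos[OF J a q] by simp
  qed
  have fsum: "finsum ?M (\<lambda>i. (fs ! i) \<odot>\<^bsub>?M\<^esub> (J +>\<^bsub>?R\<^esub> c i)) {..<length fs}
      = J +>\<^bsub>?R\<^esub> (\<Sum>i<length fs. fs ! i * c i)" if c: "c \<in> {..<length fs} \<rightarrow> carrier ?R" for c
  proof -
    \<comment> \<open>A finite sum sees only the additive structure, which
      \<open>quot_module\<close> shares with the quotient ring.\<close>
    have "finsum ?M (\<lambda>i. (fs ! i) \<odot>\<^bsub>?M\<^esub> (J +>\<^bsub>?R\<^esub> c i)) {..<length fs}
      = finsum (?R Quot J) (\<lambda>i. (J +>\<^bsub>?R\<^esub> fs ! i) \<otimes>\<^bsub>?R Quot J\<^esub> (J +>\<^bsub>?R\<^esub> c i)) {..<length fs}"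
      by (simp add: quot_module_def finsum_def finprod_def)
    also have "\<dots> = finsum (?R Quot J) (\<lambda>i. J +>\<^bsub>?R\<^esub> (fs ! i \<otimes>\<^bsub>?R\<^esub> c i)) {..<length fs}"
      using c nth by (intro Q.finsum_cong')
        (auto intro!: Q.m_closed h.hom_mult[symmetric] simp del: mpoly_ring_simps simp: Pi_iff)
    also have "\<dots> = J +>\<^bsub>?R\<^esub> finsum ?R (\<lambda>i. fs ! i \<otimes>\<^bsub>?R\<^esub> c i) {..<length fs}"
      using c nth by (subst h.hom_finsum) (auto simp: o_def intro!: mpoly_mult_closed)
    also have "finsum ?R (\<lambda>i. fs ! i \<otimes>\<^bsub>?R\<^esub> c i) {..<length fs} = (\<Sum>i<length fs. fs ! i * c i)"
      using c nth by (subst finsum_mpoly_ring) (auto intro!: mpoly_mult_closed)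
    finally show ?thesis .
  qed
  show ?thesis
  proof
    assume "J +>\<^bsub>?R\<^esub> a \<in> seq_times_module ?R ?M fs"
    then obtain m where m: "m \<in> {..<length fs} \<rightarrow> carrier ?M"
      "J +>\<^bsub>?R\<^esub> a = finsum ?M (\<lambda>i. (fs ! i) \<odot>\<^bsub>?M\<^esub> m i) {..<length fs}"
      by (auto simp: seq_times_module_def)
    \<comment> \<open>Polynomial representatives of the module coefficients.\<close>
    have "\<exists>c. \<forall>i<length fs. c i \<in> carrier ?R \<and> m i = J +>\<^bsub>?R\<^esub> c i"
      using m(1) by (intro choice) (auto simp: quot_module_def FactRing_def A_RCOSETS_def' Pi_iff)
    then obtain c where c: "\<forall>i<length fs. c i \<in> carrier ?R \<and> m i = J +>\<^bsub>?R\<^esub> c i" by blast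
    then have c': "c \<in> {..<length fs} \<rightarrow> carrier ?R" by auto
    have "finsum ?M (\<lambda>i. (fs ! i) \<odot>\<^bsub>?M\<^esub> m i) {..<length fs}
        = finsum ?M (\<lambda>i. (fs ! i) \<odot>\<^bsub>?M\<^esub> (J +>\<^bsub>?R\<^esub> c i)) {..<length fs}"
    proof -
      interpret M: module ?R ?M by (rule module_quot_module[OF is_cring J])
      have "J +>\<^bsub>?R\<^esub> c i \<in> carrier ?M" if "i < length fs" for i
        using c m(1) that by (auto simp: Pi_iff)
      then show ?thesis using c nth by (intro M.finsum_cong') (auto intro!: M.smult_closed)
    qed
    then have "J +>\<^bsub>?R\<^esub> a = J +>\<^bsub>?R\<^esub> (\<Sum>i<length fs. fs ! i * c i)" using m(2) fsum[OF c'] by simp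
    moreover have "(\<Sum>i<length fs. fs ! i * c i) \<in> carrier ?R"
      using c nth by (intro mpoly_sum_closed mpoly_mult_closed) auto
    ultimately have "a - (\<Sum>i<length fs. fs ! i * c i) \<in> J" using eq by simp
    then show "\<exists>q \<in> seq_span V fs. a - q \<in> J" using c' by (auto simp: seq_span_def)
  next
    assume "\<exists>q \<in> seq_span V fs. a - q \<in> J"
    then obtain c where c: "c \<in> {..<length fs} \<rightarrow> carrier ?R" "a - (\<Sum>i<length fs. fs ! i * c i) \<in> J"
      by (auto simp: seq_span_def)
    have "(\<Sum>i<length fs. fs ! i * c i) \<in> carrier ?R"
      using c nth by (intro mpoly_sum_closed mpoly_mult_closed) auto
    then have "J +>\<^bsub>?R\<^esub> a = J +>\<^bsub>?R\<^esub> (\<Sum>i<length fs. fs ! i * c i)" using eq c(2) by simp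
    also have "\<dots> = finsum ?M (\<lambda>i. (fs ! i) \<odot>\<^bsub>?M\<^esub> (J +>\<^bsub>?R\<^esub> c i)) {..<length fs}"
      by (rule fsum[OF c(1), symmetric])
    finally show "J +>\<^bsub>?R\<^esub> a \<in> seq_times_module ?R ?M fs"
      unfolding seq_times_module_def using c(1)
      by (intro CollectI exI[of _ "\<lambda>i. J +>\<^bsub>?R\<^esub> c i"]) (auto simp: quot_module_def)
  qed
qed

text \<open>The ideal \<open>J + (fs)\<close>.\<close>

definition ideal_sum_seq :: "'v set \<Rightarrow> ('v, 'k::comm_ring_1) mpol set \<Rightarrow> ('v, 'k) mpol list \<Rightarrow> ('v, 'k) mpol set" where
  "ideal_sum_seq V J fs = {p + q | p q. p \<in> J \<and> q \<in> seq_span V fs}"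

lemma mem_ideal_sum_seq: "a \<in> ideal_sum_seq V J fs \<longleftrightarrow> (\<exists>q \<in> seq_span V fs. a - q \<in> J)"
proof
  assume "\<exists>q \<in> seq_span V fs. a - q \<in> J"
  then obtain q where "q \<in> seq_span V fs" "a - q \<in> J" by blast
  moreover have "a = (a - q) + q" by simp
  ultimately show "a \<in> ideal_sum_seq V J fs" unfolding ideal_sum_seq_def by blast
qed (unfold ideal_sum_seq_def, force)

text \<open>Since every element of the module is a coset, being a non-zero-divisor becomes
  cancellation modulo \<open>J + (prefix)\<close>, and the non-vanishing of the last quotient
  becomes properness of \<open>J + (fs)\<close>.\<close>

lemma regular_sequence_iff:
  fixes J :: "('v, 'k::comm_ring_1) mpol set"
  assumes J: "ideal J (mpoly_ring V)" and fs: "set fs \<subseteq> carrier (mpoly_ring V)"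
  shows "regular_sequence (mpoly_ring V) (quot_module (mpoly_ring V) J) fs \<longleftrightarrow>
    (\<forall>i < length fs. \<forall>a \<in> carrier (mpoly_ring V).
        fs ! i * a \<in> ideal_sum_seq V J (take i fs) \<longrightarrow> a \<in> ideal_sum_seq V J (take i fs))
    \<and> \<not> carrier (mpoly_ring V) \<subseteq> ideal_sum_seq V J fs"
proof -
  let ?R = "mpoly_ring V :: ('v, 'k) mpol ring"
  let ?M = "quot_module ?R J"
  interpret cring ?R by (rule cring_mpoly_ring)
  interpret J: ideal J ?R by fact
  interpret h: ring_hom_cring ?R "?R Quot J" "a_r_coset ?R J"
    by (rule J.rcos_ring_hom_cring[OF is_cring])
  interpret M: module ?R ?M by (rule module_quot_module[OF is_cring J])
  have nth: "fs ! i \<in> carrier ?R" if "i < length fs" for i using that fs by auto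
  have carr: "carrier ?M = (\<lambda>a. J +>\<^bsub>?R\<^esub> a) ` carrier ?R"
    by (auto simp: quot_module_def FactRing_def A_RCOSETS_def')
  have sm: "(fs ! i) \<odot>\<^bsub>?M\<^esub> (J +>\<^bsub>?R\<^esub> a) = J +>\<^bsub>?R\<^esub> (fs ! i * a)" if "i < length fs" "a \<in> carrier ?R" for i a
    using h.hom_mult[OF nth[OF that(1)] that(2)] by (simp add: quot_module_def)
  have mem: "J +>\<^bsub>?R\<^esub> a \<in> seq_times_module ?R ?M (take i fs) \<longleftrightarrow> a \<in> ideal_sum_seq V J (take i fs)"
    if "a \<in> carrier ?R" for a i
    unfolding mem_ideal_sum_seq
    by (rule mem_seq_times_quot_module[OF J _ that]) (use fs set_take_subset[of i fs] in blast)
  have sub: "seq_times_module ?R ?M fs \<subseteq> carrier ?M"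
    unfolding seq_times_module_def using nth by (auto intro!: M.finsum_closed)
  have "seq_times_module ?R ?M fs \<noteq> carrier ?M \<longleftrightarrow> \<not> carrier ?R \<subseteq> ideal_sum_seq V J fs"
    using sub mem[of _ "length fs"] by (auto simp: carr)
  moreover have "(\<forall>m \<in> carrier ?M. (fs ! i) \<odot>\<^bsub>?M\<^esub> m \<in> seq_times_module ?R ?M (take i fs) \<longrightarrow>
        m \<in> seq_times_module ?R ?M (take i fs)) \<longleftrightarrow> (\<forall>a \<in> carrier ?R.
        fs ! i * a \<in> ideal_sum_seq V J (take i fs) \<longrightarrow> a \<in> ideal_sum_seq V J (take i fs))"
    if "i < length fs" for i
    using that nth mpoly_mult_closed[of _ V "fs ! i"] by (simp add: carr sm mem)
  ultimately show ?thesis unfolding regular_sequence_def using fs by blast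
qed

text \<open>This is the vanishing of Tor_1 of \<open>R/J\<close> and \<open>R/(fs)\<close> for a
  sequence regular on \<open>R/J\<close>. It supplies the kernel condition in
  \<open>is_polarization\<close>, and is proved by induction over prefixes.\<close>

lemma regular_sequence_inter:
  fixes J :: "('v, 'k::comm_ring_1) mpol set"
  assumes J: "ideal J (mpoly_ring V)" and fs: "set fs \<subseteq> carrier (mpoly_ring V)"
    and reg: "\<forall>i < length fs. \<forall>a \<in> carrier (mpoly_ring V).
        fs ! i * a \<in> ideal_sum_seq V J (take i fs) \<longrightarrow> a \<in> ideal_sum_seq V J (take i fs)"
  shows "J \<inter> seq_span V fs \<subseteq> (Idl\<^bsub>mpoly_ring V\<^esub> (set fs)) \<cdot>\<^bsub>mpoly_ring V\<^esub> J"
proof -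
  let ?R = "mpoly_ring V :: ('v, 'k) mpol ring"
  let ?P = "(Idl\<^bsub>?R\<^esub> (set fs)) \<cdot>\<^bsub>?R\<^esub> J"
  interpret cring ?R by (rule cring_mpoly_ring)
  have P: "ideal ?P ?R"
    by (intro ideal_prod_is_ideal J genideal_ideal fs)
  have "J \<inter> seq_span V (take k fs) \<subseteq> ?P" if "k \<le> length fs" for k
    using that
  proof (induction k)
    case 0
    then show ?case using mpoly_ideal_0[OF P] by auto
  next
    case (Suc k)
    let ?f = "fs ! k"
    have k: "k < length fs" and f: "?f \<in> carrier ?R" using Suc.prems fs by auto
    have span: "ideal (seq_span V (take k fs)) ?R"
      using fs set_take_subset[of k fs] by (intro Idl_set_eq_seq_span(2)) blast
    show ?case
    proof
      fix p assume "p \<in> J \<inter> seq_span V (take (Suc k) fs)"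
      then obtain q a where p: "p \<in> J" "p = q + ?f * a" "q \<in> seq_span V (take k fs)" "a \<in> carrier ?R"
        unfolding take_Suc_conv_app_nth[OF k] seq_span_snoc by blast
      \<comment> \<open>\<open>?f * a = p - q\<close> is an element of \<open>J\<close> minus one of
        the span of the prefix, so regularity splits \<open>a\<close> itself as
        \<open>g + b\<close>.\<close>
      have "?f * a \<in> ideal_sum_seq V J (take k fs)"
        unfolding mem_ideal_sum_seq using mpoly_ideal_diff[OF span mpoly_ideal_0[OF span] p(3)] p(1,2)
        by (intro bexI[of _ "0 - q"]) (auto simp: algebra_simps)
      then have "a \<in> ideal_sum_seq V J (take k fs)" using reg k p(4) by blast
      then obtain g b where g: "g \<in> J" "b \<in> seq_span V (take k fs)" "a = g + b"
        by (auto simp: ideal_sum_seq_def)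
      \<comment> \<open>Subtracting \<open>?f * g\<close>, which lies in the product ideal, leaves
        \<open>q + ?f * b\<close>, an element of \<open>J\<close> in the span of the shorter
        prefix.\<close>
      have "?f * g \<in> J" by (rule mpoly_ideal_mult[OF J g(1) f])
      then have "p - ?f * g \<in> J" by (rule mpoly_ideal_diff[OF J p(1)])
      moreover have "q + ?f * b \<in> seq_span V (take k fs)"
        by (intro mpoly_ideal_add[OF span] p mpoly_ideal_mult[OF span] g f)
      then have "p - ?f * g \<in> seq_span V (take k fs)" by (simp add: p(2) g(3) algebra_simps)
      ultimately have "p - ?f * g \<in> ?P" using Suc by auto
      moreover have "?f * g \<in> ?P"
        using ideal_prod.prod[of ?f "Idl\<^bsub>?R\<^esub> (set fs)" g J ?R] genideal_self[OF fs] nth_mem[OF k] g(1)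
        by (simp add: subset_iff)
      ultimately show "p \<in> ?P" using mpoly_ideal_add[OF P, of "p - ?f * g" "?f * g"] by simp
    qed
  qed
  from this[of "length fs"] show ?thesis by simp
qed

section \<open>Identification of variables\<close>

text \<open>One stage of dividing out: the variables in \<open>A\<close>, in practice a prefix of
  the list of eliminated variables, are replaced by the first variable over the same index.\<close>

definition merge :: "(nat \<times> nat) set \<Rightarrow> nat \<times> nat \<Rightarrow> nat \<times> nat" where
  "merge A v = (if v \<in> A then (fst v, 1) else v)"

lemma fst_merge [simp]: "fst (merge A v) = fst v"
  by (simp add: merge_def)

lemma merge_empty [simp]: "merge {} = id"
  by (auto simp: merge_def)

lemma merge_insert:
  assumes "(i, 1) \<notin> insert x A" "fst x = i" "x \<notin> A"
  shows "merge (insert x A) v = (if merge A v = x then (i, 1) else merge A v)"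
  using assms by (auto simp: merge_def)

text \<open>First variables are never eliminated and are always available as targets. This makes
  \<open>merge A\<close> an idempotent map of \<open>V\<close> to itself.\<close>

definition merge_closed :: "(nat \<times> nat) set \<Rightarrow> (nat \<times> nat) set \<Rightarrow> bool" where
  "merge_closed V A \<longleftrightarrow> A \<subseteq> V \<and> (\<forall>v \<in> A. snd v \<noteq> 1 \<and> (fst v, 1) \<in> V)"

lemma merge_idem: "merge_closed V A \<Longrightarrow> merge A (merge A v) = merge A v"
  by (auto simp: merge_def merge_closed_def)

lemma merge_in: "merge_closed V A \<Longrightarrow> v \<in> V \<Longrightarrow> merge A v \<in> V"
  by (auto simp: merge_def merge_closed_def)

definition merge_vimage :: "(nat \<times> nat) set \<Rightarrow> (nat \<times> nat) set \<Rightarrow> (nat \<times> nat) set \<Rightarrow> (nat \<times> nat) set" where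
  "merge_vimage V A M = {v \<in> V. merge A v \<in> M}"

text \<open>The supports of the ideal after identification, still written in the variables
  \<open>V\<close>. If \<open>fst\<close> is injective on \<open>s\<close>, the monomial of
  \<open>s\<close> is sent to a square-free one, which divides a monomial with support
  \<open>M\<close> iff \<open>s\<close> is contained in \<open>merge_vimage V A M\<close>. When
  \<open>merge_closed V A\<close> holds, the elements of \<open>A\<close> in \<open>M\<close> have
  no preimage and do not influence membership.\<close>

definition merged :: "(nat \<times> nat) set \<Rightarrow> (nat \<times> nat) set set \<Rightarrow> (nat \<times> nat) set \<Rightarrow> (nat \<times> nat) set set" where
  "merged V U A = {M. M \<subseteq> V \<and> merge_vimage V A M \<in> U}"

text \<open>Generators of this kind stay square-free when variables over the same index are
  identified.\<close>

definition transversal_generated :: "(nat \<times> nat) set set \<Rightarrow> bool" where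
  "transversal_generated U \<longleftrightarrow> (\<forall>M \<in> U. \<exists>s \<in> U. s \<subseteq> M \<and> inj_on fst s)"

lemma merge_vimage_mono: "M \<subseteq> N \<Longrightarrow> merge_vimage V A M \<subseteq> merge_vimage V A N"
  by (auto simp: merge_vimage_def)

lemma merge_vimage_subset: "merge_vimage V A M \<subseteq> V"
  by (auto simp: merge_vimage_def)

lemma upset_merged: "upset V U \<Longrightarrow> upset V (merged V U A)"
proof -
  assume U: "upset V U"
  have "merge_vimage V A N \<in> U" if "merge_vimage V A M \<in> U" "M \<subseteq> N" for M N
    by (rule upsetD[OF U that(1) merge_vimage_mono[OF that(2)] merge_vimage_subset])
  then show ?thesis unfolding upset_def merged_def by blast
qed

definition var_diffs :: "(nat \<times> nat) list \<Rightarrow> (nat \<times> nat, 'k::comm_ring_1) mpol list" where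
  "var_diffs L = map (\<lambda>v. mvar (fst v, 1) - mvar v) L"

lemma var_diffs_closed: "merge_closed V (set L) \<Longrightarrow> set (var_diffs L) \<subseteq> carrier (mpoly_ring V)"
  by (auto simp: var_diffs_def merge_closed_def intro!: mpoly_diff_closed mvar_closed)

lemma mem_seq_span:
  assumes "set fs \<subseteq> carrier (mpoly_ring V)" "f \<in> set fs"
  shows "f \<in> seq_span V fs"
proof -
  interpret cring "mpoly_ring V :: ('a, 'b) mpol ring" by (rule cring_mpoly_ring)
  show ?thesis
    using Idl_set_eq_seq_span(1)[OF assms(1)] genideal_self[OF assms(1)] assms(2) by auto
qed

lemma relab_closed:
  assumes "p \<in> carrier (mpoly_ring V)" "\<And>v. v \<in> V \<Longrightarrow> f v \<in> W"
  shows "relab f p \<in> carrier (mpoly_ring W)"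
  using assms keys_relab[of f p] by (fastforce simp: mem_carrier_mpoly_ring keys_push)

text \<open>A monomial is replaced by its merged form one variable at a time, each replacement
  costing a multiple of a difference. In particular, polynomials killed by the identification lie in
  the span of the differences.\<close>

lemma relab_merge_diff:
  fixes p :: "(nat \<times> nat, 'k::comm_ring_1) mpol"
  assumes L: "merge_closed V (set L)" and p: "p \<in> carrier (mpoly_ring V)"
  shows "p - relab (merge (set L)) p \<in> seq_span V (var_diffs L)"
proof -
  let ?K = "seq_span V (var_diffs L) :: (nat \<times> nat, 'k) mpol set" and ?\<pi> = "merge (set L)"
  have K: "ideal ?K (mpoly_ring V)" by (rule Idl_set_eq_seq_span(2)[OF var_diffs_closed[OF L]])
  have v: "mvar v - mvar (?\<pi> v) \<in> ?K" for v
  proof (cases "v \<in> set L")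
    case True
    then have "mvar (fst v, 1) - mvar v \<in> ?K"
      by (intro mem_seq_span[OF var_diffs_closed[OF L]]) (auto simp: var_diffs_def)
    from mpoly_ideal_diff[OF K mpoly_ideal_0[OF K] this] True show ?thesis
      by (simp add: merge_def)
  qed (simp add: merge_def mpoly_ideal_0[OF K])
  have *: "Poly_Mapping.keys m \<subseteq> V \<longrightarrow> Poly_Mapping.single m c - relab ?\<pi> (Poly_Mapping.single m c) \<in> ?K" for m and c :: 'k
  proof (induction m rule: poly_mapping_nat_induct)
    case zero
    then show ?case by (simp add: relab_single mpoly_ideal_0[OF K])
  next
    case (add v m)
    show ?case
    proof
      assume sub: "Poly_Mapping.keys (Poly_Mapping.single v 1 + m) \<subseteq> V"
      then have vV: "v \<in> V" and mV: "Poly_Mapping.keys m \<subseteq> V" by (auto simp: keys_add_nat)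
      let ?q = "Poly_Mapping.single m c"
      have e: "Poly_Mapping.single (Poly_Mapping.single v 1 + m) c = mvar v * ?q"
        by (simp add: mvar_def mult_single)
      \<comment> \<open>Telescoping: first the new variable is exchanged, then the induction
        hypothesis is multiplied by its image.\<close>
      have "mvar v * ?q - relab ?\<pi> (mvar v * ?q) = ?q * (mvar v - mvar (?\<pi> v)) + mvar (?\<pi> v) * (?q - relab ?\<pi> ?q)"
        by (simp only: relab_mvar_mult) (simp add: algebra_simps)
      also have "\<dots> \<in> ?K"
        using add mV by (intro mpoly_ideal_add[OF K] mpoly_ideal_mult[OF K] v single_closed mvar_closed merge_in[OF L] vV) auto
      finally show "Poly_Mapping.single (Poly_Mapping.single v 1 + m) c -
        relab ?\<pi> (Poly_Mapping.single (Poly_Mapping.single v 1 + m) c) \<in> ?K" by (simp only: e)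
    qed
  qed
  have "p - relab ?\<pi> p = (\<Sum>m \<in> Poly_Mapping.keys p. Poly_Mapping.single m (Poly_Mapping.lookup p m) -
      relab ?\<pi> (Poly_Mapping.single m (Poly_Mapping.lookup p m)))"
    by (simp add: sum_subtractf relab_single flip: relab_eq[OF finite_keys order_refl] poly_mapping_sum_keys[OF finite_keys order_refl])
  also have "\<dots> \<in> ?K"
    using p * by (intro mpoly_ideal_sum[OF K]) (auto simp: mem_carrier_mpoly_ring)
  finally show ?thesis .
qed

text \<open>Stated for any \<open>f\<close> that identifies the pairs, so as to cover the partial
  identifications as well as \<open>depol\<close>.\<close>

lemma relab_seq_span:
  assumes f: "\<And>v. v \<in> set L \<Longrightarrow> f v = f (fst v, 1)" and q: "q \<in> seq_span V (var_diffs L)"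
  shows "relab f q = 0"
proof -
  obtain c where q: "q = (\<Sum>i<length L. var_diffs L ! i * c i)" using q by (auto simp: seq_span_def var_diffs_def)
  have "relab f (var_diffs L ! i * c i) = 0" if "i < length L" for i
    using that f[OF nth_mem[OF that]] by (simp add: var_diffs_def left_diff_distrib relab_diff relab_mvar_mult)
  then show ?thesis by (simp add: q relab_sum)
qed

text \<open>A monomial whose support lies in the merged family is congruent, modulo the differences, to one
  divisible by a transversal member of the original family.\<close>

lemma mem_ideal_sum_seq_var_diffs:
  fixes p :: "(nat \<times> nat, 'k::comm_ring_1) mpol"
  assumes U: "upset V U" and fin: "finite V" and tr: "transversal_generated U"
    and L: "merge_closed V (set L)" and p: "p \<in> carrier (mpoly_ring V)"
  shows "p \<in> ideal_sum_seq V (support_ideal V U) (var_diffs L) \<longleftrightarrow>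
    relab (merge (set L)) p \<in> support_ideal V (merged V U (set L))"
proof
  let ?\<pi> = "merge (set L)" and ?K = "seq_span V (var_diffs L) :: (nat \<times> nat, 'k) mpol set"
  have UM: "upset V (merged V U (set L))" by (rule upset_merged[OF U])
  assume "p \<in> ideal_sum_seq V (support_ideal V U) (var_diffs L)"
  then obtain a q where a: "a \<in> support_ideal V U" "q \<in> ?K" "p = a + q"
    by (auto simp: ideal_sum_seq_def)
  have "relab ?\<pi> q = 0" using L by (intro relab_seq_span[OF _ a(2)]) (auto simp: merge_def merge_closed_def)
  then have eq: "relab ?\<pi> p = relab ?\<pi> a" by (simp add: a(3) relab_add)
  have "Poly_Mapping.keys m \<in> merged V U (set L)" if m: "m \<in> Poly_Mapping.keys (relab ?\<pi> a)" for m
  proof -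
    obtain m' where m': "m' \<in> Poly_Mapping.keys a" "m = push ?\<pi> m'"
      using subsetD[OF keys_relab m] by blast
    then have "Poly_Mapping.keys m' \<in> U" using a(1) by (simp add: support_ideal_iff[OF U])
    moreover from this have mV: "Poly_Mapping.keys m' \<subseteq> V" by (rule upset_subset[OF U])
    \<comment> \<open>A support lies in the preimage of its image, hence up-closedness
      applies.\<close>
    moreover have "Poly_Mapping.keys m' \<subseteq> merge_vimage V (set L) (Poly_Mapping.keys m)"
      using mV by (auto simp: m'(2) keys_push merge_vimage_def)
    ultimately have "merge_vimage V (set L) (Poly_Mapping.keys m) \<in> U" using upsetD[OF U] merge_vimage_subset by blast
    moreover have "Poly_Mapping.keys m \<subseteq> V" using merge_in[OF L] mV by (auto simp: m'(2) keys_push)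
    ultimately show ?thesis by (simp add: merged_def)
  qed
  then show "relab ?\<pi> p \<in> support_ideal V (merged V U (set L))"
    by (simp add: eq support_ideal_iff[OF UM])
next
  let ?\<pi> = "merge (set L)" and ?K = "seq_span V (var_diffs L) :: (nat \<times> nat, 'k) mpol set"
  have UM: "upset V (merged V U (set L))" by (rule upset_merged[OF U])
  have J: "ideal (support_ideal V U :: (nat \<times> nat, 'k) mpol set) (mpoly_ring V)" by (rule ideal_support_ideal[OF U])
  have K: "ideal ?K (mpoly_ring V)" by (rule Idl_set_eq_seq_span(2)[OF var_diffs_closed[OF L]])
  assume q: "relab ?\<pi> p \<in> support_ideal V (merged V U (set L))"
  have mon: "\<exists>a. Poly_Mapping.keys a \<in> U \<and> push ?\<pi> a = push ?\<pi> m"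
    if m: "m \<in> push ?\<pi> ` Poly_Mapping.keys p" "Poly_Mapping.keys m \<in> merged V U (set L)" for m
  proof -
    have mV: "Poly_Mapping.keys m \<subseteq> V" using m(2) by (simp add: merged_def)
    from m(2) tr obtain s where s: "s \<in> U" "s \<subseteq> merge_vimage V (set L) (Poly_Mapping.keys m)" "inj_on fst s"
      unfolding merged_def transversal_generated_def by blast
    have sfin: "finite s" using finite_subset[OF upset_subset[OF U s(1)] fin] .
    have inj: "inj_on ?\<pi> s" using s(3) by (metis fst_merge inj_on_def)
    \<comment> \<open>\<open>?n\<close> is the exponent vector of the merged monomial of
      \<open>s\<close>, and it divides \<open>m\<close>. Exchanging it for the unmerged monomial of
      \<open>s\<close> gives \<open>?a\<close>, which has the same image as \<open>m\<close> and a
      support containing \<open>s\<close>; here \<open>s\<close> being transversal makes merging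
      injective on it.\<close>
    let ?n = "\<Sum>v \<in> ?\<pi> ` s. Poly_Mapping.single v (1::nat)"
    have lk: "Poly_Mapping.lookup ?n w = (if w \<in> ?\<pi> ` s then 1 else 0)" for w
      using sfin by (simp add: lookup_sum lookup_single when_def sum.delta)
    have dv: "m = (m - ?n) + ?n"
      using s(2) by (intro poly_mapping_eqI) (auto simp: lookup_add lookup_minus lk in_keys_iff merge_vimage_def simp del: One_nat_def)
    let ?a = "(m - ?n) + (\<Sum>v \<in> s. Poly_Mapping.single v (1::nat))"
    have "push ?\<pi> (\<Sum>v \<in> s. Poly_Mapping.single v (1::nat)) = (\<Sum>v \<in> s. Poly_Mapping.single (?\<pi> v) 1)"
      using sfin by (induction s rule: finite_induct) (simp_all add: push_add push_single)
    also have "\<dots> = ?n" by (simp add: sum.reindex[OF inj])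
    also have "\<dots> = push ?\<pi> ?n"
      using sfin inj by (simp add: sum.reindex[OF inj]) (induction s rule: finite_induct, simp_all add: push_add push_single merge_idem[OF L])
    finally have "push ?\<pi> ?a = push ?\<pi> ((m - ?n) + ?n)" by (simp only: push_add)
    then have "push ?\<pi> ?a = push ?\<pi> m" by (simp only: dv[symmetric])
    moreover have "Poly_Mapping.keys ?a \<in> U"
    proof (rule upsetD[OF U s(1)])
      show "s \<subseteq> Poly_Mapping.keys ?a" by (simp add: keys_add_nat keys_sum_single[OF sfin] del: One_nat_def)
      show "Poly_Mapping.keys ?a \<subseteq> V"
        using mV upset_subset[OF U s(1)] by (simp add: keys_add_nat keys_sum_single[OF sfin] del: One_nat_def)
          (auto simp: in_keys_iff lookup_minus)
    qed
    ultimately show ?thesis by blast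
  qed
  define q where "q = relab ?\<pi> p"
  have "\<forall>m \<in> Poly_Mapping.keys q. \<exists>a. Poly_Mapping.keys a \<in> U \<and> push ?\<pi> a = push ?\<pi> m"
    using q keys_relab[of ?\<pi> p] mon by (auto simp: q_def support_ideal_iff[OF UM])
  then obtain a where a: "\<forall>m \<in> Poly_Mapping.keys q. Poly_Mapping.keys (a m) \<in> U \<and> push ?\<pi> (a m) = push ?\<pi> m"
    by metis
  \<comment> \<open>A lift of \<open>q\<close> into the original ideal, term by term. Since
    \<open>b\<close> and \<open>p\<close> have the same image, their difference is in the span of
    the differences.\<close>
  define b where "b = (\<Sum>m \<in> Poly_Mapping.keys q. Poly_Mapping.single (a m) (Poly_Mapping.lookup q m))"
  have b: "b \<in> support_ideal V U"
    unfolding b_def using a by (intro mpoly_ideal_sum[OF J] single_in_support_ideal[OF U]) blast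
  have "relab ?\<pi> b = relab ?\<pi> q"
    unfolding b_def using a by (simp add: relab_sum relab_single relab_eq[OF finite_keys order_refl, of ?\<pi> q])
  also have "\<dots> = relab ?\<pi> p" by (simp add: q_def relab_relab merge_idem[OF L])
  finally have e: "relab ?\<pi> (p - b) = 0" by (simp add: relab_diff)
  have "p - b \<in> carrier (mpoly_ring V)" by (intro mpoly_diff_closed p mpoly_ideal_carrier[OF J b])
  from relab_merge_diff[OF L this] have "p - b \<in> ?K" by (simp add: e)
  then show "p \<in> ideal_sum_seq V (support_ideal V U) (var_diffs L)"
    unfolding mem_ideal_sum_seq using b by (intro bexI[of _ "p - b"]) auto
qed

section \<open>Cancelling a difference of two variables modulo a square-free monomial ideal\<close>

lemma mult_diff_coeff:
  fixes q :: "('v, 'k::comm_ring_1) mpol"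
  assumes "m \<in> Poly_Mapping.keys q" "Poly_Mapping.single x 1 + m \<notin> Poly_Mapping.keys ((mvar x - mvar y) * q)"
  shows "\<exists>m' \<in> Poly_Mapping.keys q. Poly_Mapping.single x 1 + m = Poly_Mapping.single y 1 + m'"
proof -
  have "Poly_Mapping.lookup (mvar x * q) (Poly_Mapping.single x 1 + m) = Poly_Mapping.lookup (mvar y * q) (Poly_Mapping.single x 1 + m)"
    using assms(2) by (simp add: left_diff_distrib in_keys_iff lookup_minus)
  then have "Poly_Mapping.single x 1 + m \<in> Poly_Mapping.keys (mvar y * q)"
    using assms(1) lookup_mvar_mult[of x q m] by (simp add: in_keys_iff)
  then show ?thesis by (auto simp: keys_mvar_mult)
qed

text \<open>Among the offending monomials of \<open>q\<close>, take one, \<open>a\<close>, with the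
  largest exponent of \<open>x\<close>. Its product with \<open>x\<close> cannot survive in the
  product, so it cancels against \<open>y\<close> times some monomial \<open>b\<close>. Then
  \<open>b\<close> is offending too and has a larger exponent of \<open>x\<close>.\<close>

lemma insert_keys_in_upset:
  fixes q :: "('v, 'k::comm_ring_1) mpol"
  assumes U: "upset V U" and q: "q \<in> carrier (mpoly_ring V)" and xV: "x \<in> V" and xy: "x \<noteq> y"
    and prod: "(mvar x - mvar y) * q \<in> support_ideal V U"
    and m: "m \<in> Poly_Mapping.keys q"
  shows "insert x (Poly_Mapping.keys m) \<in> U"
proof (rule ccontr)
  assume "insert x (Poly_Mapping.keys m) \<notin> U"
  define T where "T = {a \<in> Poly_Mapping.keys q. insert x (Poly_Mapping.keys a) \<notin> U}"
  have "T \<noteq> {}" "finite T" using m \<open>insert x (Poly_Mapping.keys m) \<notin> U\<close> by (auto simp: T_def)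
  then have "Max ((\<lambda>b. Poly_Mapping.lookup b x) ` T) \<in> (\<lambda>b. Poly_Mapping.lookup b x) ` T" by simp
  then obtain a where a: "a \<in> T" "Max ((\<lambda>b. Poly_Mapping.lookup b x) ` T) = Poly_Mapping.lookup a x" by blast
  then have le: "Poly_Mapping.lookup b x \<le> Poly_Mapping.lookup a x" if "b \<in> T" for b
    using that \<open>finite T\<close> by (metis Max_ge finite_imageI imageI)
  have "Poly_Mapping.single x 1 + a \<notin> Poly_Mapping.keys ((mvar x - mvar y) * q)"
    using a(1) prod by (auto simp: T_def support_ideal_iff[OF U] keys_add_nat)
  moreover have "a \<in> Poly_Mapping.keys q" using a(1) by (simp add: T_def)
  ultimately obtain b where b: "b \<in> Poly_Mapping.keys q"
    "Poly_Mapping.single x 1 + a = Poly_Mapping.single y 1 + b"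
    using mult_diff_coeff[of a q x y] by blast
  have "Poly_Mapping.lookup b x = Suc (Poly_Mapping.lookup a x)"
    using arg_cong[OF b(2), of "\<lambda>m. Poly_Mapping.lookup m x"] xy by (simp add: lookup_add lookup_single when_def)
  \<comment> \<open>Thus a good support for \<open>b\<close> would make the one for \<open>a\<close>
    good, by up-closedness.\<close>
  moreover have "insert x (Poly_Mapping.keys b) \<subseteq> insert x (Poly_Mapping.keys a)"
    using arg_cong[OF b(2), of Poly_Mapping.keys] by (auto simp: keys_add_nat)
  moreover have "insert x (Poly_Mapping.keys a) \<subseteq> V"
    using xV q a(1) by (auto simp: T_def mem_carrier_mpoly_ring)
  ultimately have "b \<in> T" using b(1) a(1) upsetD[OF U] by (auto simp: T_def)
  with le \<open>Poly_Mapping.lookup b x = _\<close> show False by fastforce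
qed

text \<open>The preceding lemma, applied also with the roles of \<open>x\<close> and
  \<open>y\<close> exchanged (which costs a sign), gives both premises of \<open>cond\<close> for
  the support of every monomial of \<open>q\<close>.\<close>

lemma diff_cancel_support_ideal:
  fixes q :: "('v, 'k::comm_ring_1) mpol"
  assumes U: "upset V U" and q: "q \<in> carrier (mpoly_ring V)" and "x \<in> V" "y \<in> V" "x \<noteq> y"
    and prod: "(mvar x - mvar y) * q \<in> support_ideal V U"
    and cond: "\<And>M. M \<subseteq> V \<Longrightarrow> insert x M \<in> U \<Longrightarrow> insert y M \<in> U \<Longrightarrow> M \<in> U"
  shows "q \<in> support_ideal V U"
proof -
  have "(mvar y - mvar x) * q = - 1 * ((mvar x - mvar y) * q)" by (simp add: algebra_simps)
  also have "\<dots> \<in> support_ideal V U"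
    by (intro mpoly_ideal_mult[OF ideal_support_ideal[OF U]] prod) (simp add: mem_carrier_mpoly_ring)
  finally have "(mvar y - mvar x) * q \<in> support_ideal V U" .
  note y = insert_keys_in_upset[OF U q \<open>y \<in> V\<close> \<open>x \<noteq> y\<close>[symmetric] this]
  note x = insert_keys_in_upset[OF U q \<open>x \<in> V\<close> \<open>x \<noteq> y\<close> prod]
  show ?thesis
    using cond q x y unfolding support_ideal_iff[OF U] mem_carrier_mpoly_ring by blast
qed

text \<open>The combinatorial form of regularity: at each stage, the difference to be divided out
  next is a non-zero-divisor modulo the merged ideal.\<close>

definition merge_exchange :: "(nat \<times> nat) set \<Rightarrow> (nat \<times> nat) set set \<Rightarrow> (nat \<times> nat) list \<Rightarrow> bool" where
  "merge_exchange V U L \<longleftrightarrow> (\<forall>k < length L. \<forall>M \<subseteq> V.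
      insert (fst (L ! k), 1) M \<in> merged V U (set (take k L)) \<longrightarrow>
      insert (L ! k) M \<in> merged V U (set (take k L)) \<longrightarrow> M \<in> merged V U (set (take k L)))"

lemma merge_closed_subset: "merge_closed V A \<Longrightarrow> B \<subseteq> A \<Longrightarrow> merge_closed V B"
  by (auto simp: merge_closed_def)

text \<open>Membership in \<open>J + (prefix)\<close> is membership of the merged polynomial in the
  merged ideal. Merging fixes the two variables of the next difference, so it commutes with
  multiplication by it, and the question becomes cancellation modulo a square-free monomial
  ideal.\<close>

lemma regular_var_diffs_iff:
  assumes U: "upset V U" and fin: "finite V" and tr: "transversal_generated U"
    and L: "merge_closed V (set L)" and dL: "distinct L"
  shows "(\<forall>i < length (var_diffs L). \<forall>a \<in> carrier (mpoly_ring V).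
      var_diffs L ! i * a \<in> ideal_sum_seq V (support_ideal V U) (take i (var_diffs L)) \<longrightarrow>
      (a :: (nat \<times> nat, 'k::comm_ring_1) mpol) \<in> ideal_sum_seq V (support_ideal V U) (take i (var_diffs L)))
    \<longleftrightarrow> merge_exchange V U L" (is "(\<forall>i < _. ?P i) \<longleftrightarrow> _")
proof -
  have "?P k \<longleftrightarrow> (\<forall>M \<subseteq> V. insert (fst (L ! k), 1) M \<in> merged V U (set (take k L)) \<longrightarrow>
      insert (L ! k) M \<in> merged V U (set (take k L)) \<longrightarrow> M \<in> merged V U (set (take k L)))" (is "_ \<longleftrightarrow> ?Q")
    if k: "k < length L" for k
  proof -
    let ?L = "take k L" and ?y = "L ! k"
    let ?x = "(fst ?y, 1)" and ?U = "merged V U (set ?L)"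
    let ?\<pi> = "merge (set ?L)"
    have Lk: "merge_closed V (set ?L)" using merge_closed_subset[OF L] set_take_subset by metis
    have yL: "?y \<in> set L" using k by simp
    have yk: "?y \<notin> set ?L" using dL k by (auto simp: in_set_conv_nth nth_eq_iff_index_eq)
    have "snd ?y \<noteq> 1" using L yL by (simp add: merge_closed_def)
    then have xy: "?x \<noteq> ?y" by (metis snd_conv)
    \<comment> \<open>Both are fixed by the stage: \<open>?x\<close> as a first variable,
      \<open>?y\<close> because the list is distinct.\<close>
    have x: "?x \<in> V" "?x \<noteq> ?y" "?\<pi> ?x = ?x" and y: "?y \<in> V" "?\<pi> ?y = ?y"
      using L yL yk Lk xy by (auto simp: merge_closed_def merge_def)
    have tk: "take k (var_diffs L) = var_diffs ?L" and nk: "var_diffs L ! k = mvar ?x - mvar ?y"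
      using k by (simp_all add: var_diffs_def take_map)
    have UM: "upset V ?U" by (rule upset_merged[OF U])
    have cl: "(mvar ?x - mvar ?y) * a \<in> carrier (mpoly_ring V)"
      if "a \<in> carrier (mpoly_ring V)" for a :: "(nat \<times> nat, 'k) mpol"
      by (intro mpoly_mult_closed mpoly_diff_closed mvar_closed x y that)
    have P: "?P k \<longleftrightarrow> (\<forall>a \<in> carrier (mpoly_ring V). (mvar ?x - mvar ?y) * relab ?\<pi> a \<in> support_ideal V ?U
        \<longrightarrow> relab ?\<pi> (a :: (nat \<times> nat, 'k) mpol) \<in> support_ideal V ?U)"
      unfolding tk nk using cl x(3) y(2)
      by (simp add: mem_ideal_sum_seq_var_diffs[OF U fin tr Lk] left_diff_distrib relab_diff relab_mvar_mult)
    show ?thesis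
    proof
      assume Q: ?Q
      show "?P k" unfolding P
      proof (intro ballI impI)
        fix a :: "(nat \<times> nat, 'k) mpol"
        assume a: "a \<in> carrier (mpoly_ring V)" "(mvar ?x - mvar ?y) * relab ?\<pi> a \<in> support_ideal V ?U"
        have "relab ?\<pi> a \<in> carrier (mpoly_ring V)" using a(1) merge_in[OF Lk] by (rule relab_closed)
        then show "relab ?\<pi> a \<in> support_ideal V ?U"
          using Q by (intro diff_cancel_support_ideal[OF UM _ x(1) y(1) x(2) a(2)]) blast+
      qed
    next
      assume "?P k"
      note P = this[unfolded P, rule_format]
      show ?Q
      proof (intro allI impI)
        fix M assume M: "M \<subseteq> V" "insert ?x M \<in> ?U" "insert ?y M \<in> ?U"
        \<comment> \<open>Restricting to variables fixed by merging leaves all preimages unchanged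
          and makes the square-free monomial on \<open>N\<close> equal to its merged form. This
          monomial is the test polynomial for \<open>P\<close>.\<close>
        define N where "N = {v \<in> M. ?\<pi> v = v}"
        have pr: "merge_vimage V (set ?L) (insert z N) = merge_vimage V (set ?L) (insert z M)" for z
          by (auto simp: merge_vimage_def N_def merge_idem[OF Lk])
        have prN: "merge_vimage V (set ?L) N = merge_vimage V (set ?L) M"
          by (auto simp: merge_vimage_def N_def merge_idem[OF Lk])
        have N: "N \<subseteq> V" "insert ?x N \<in> ?U" "insert ?y N \<in> ?U"
          using M x(1) y(1) by (auto simp: merged_def pr) (auto simp: N_def)
        have finN: "finite N" using finite_subset[OF N(1) fin] .
        let ?n = "\<Sum>v \<in> N. Poly_Mapping.single v (1::nat)"
        let ?a = "Poly_Mapping.single ?n (1::'k)"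
        have kn: "Poly_Mapping.keys ?n = N" by (rule keys_sum_single[OF finN])
        have "push ?\<pi> (\<Sum>v \<in> N'. Poly_Mapping.single v (1::nat)) = (\<Sum>v \<in> N'. Poly_Mapping.single v 1)" if "finite N'" "N' \<subseteq> N" for N'
          using that by (induction N' rule: finite_induct) (auto simp: push_add push_single N_def)
        from this[OF finN] have ra: "relab ?\<pi> ?a = ?a" by (simp add: relab_single)
        have "mvar z * ?a \<in> support_ideal V ?U" if "insert z N \<in> ?U" for z
          using that kn unfolding mvar_def mult_single
          by (intro single_in_support_ideal[OF UM]) (simp add: keys_add_nat)
        then have "(mvar ?x - mvar ?y) * ?a \<in> support_ideal V ?U"
          using N unfolding left_diff_distrib by (intro mpoly_ideal_diff[OF ideal_support_ideal[OF UM]]) auto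
        then have "?a \<in> support_ideal V ?U"
          using P[of ?a] ra single_closed[of ?n V "1::'k"] N(1) kn by simp
        then have "N \<in> ?U" using kn by (simp add: support_ideal_iff[OF UM])
        then show "M \<in> ?U" using M(1) prN by (simp add: merged_def)
      qed
    qed
  qed
  then show ?thesis by (simp add: merge_exchange_def var_diffs_def)
qed

section \<open>Alexander duality and identification of variables\<close>

text \<open>\<open>T\<close> meets every member of an up-closed \<open>U\<close> iff its complement
  contains no member, that is, iff the complement is not in \<open>U\<close>.\<close>

definition dual_family :: "'v set \<Rightarrow> 'v set set \<Rightarrow> 'v set set" where
  "dual_family V U = {T. T \<subseteq> V \<and> V - T \<notin> U}"

lemma upset_dual_family: "upset V U \<Longrightarrow> upset V (dual_family V U)"
proof -
  assume U: "upset V U"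
  have "V - N \<notin> U" if "V - M \<notin> U" "M \<subseteq> N" for M N
    using that upsetD[OF U, of "V - N" "V - M"] by blast
  then show ?thesis by (auto simp: upset_def dual_family_def)
qed

lemma dual_family_up_closure:
  assumes "A \<subseteq> Pow V"
  shows "dual_family V (up_closure V A) = {T. T \<subseteq> V \<and> (\<forall>\<alpha> \<in> A. T \<inter> \<alpha> \<noteq> {})}"
proof -
  have "\<alpha> \<subseteq> V - T \<longleftrightarrow> T \<inter> \<alpha> = {}" if "\<alpha> \<in> A" for \<alpha> T
    using assms that by blast
  then show ?thesis by (auto simp: dual_family_def up_closure_def)
qed

lemma up_closure_upset: "upset V U \<Longrightarrow> up_closure V U = U"
  unfolding up_closure_def by (auto dest: upsetD upset_subset)

lemma alexander_dual_support_ideal: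
  assumes "finite V" "A \<subseteq> Pow V"
  shows "alexander_dual V (support_ideal V (up_closure V A) :: ('v, 'k::field) mpol set)
    = support_ideal V (dual_family V (up_closure V A))"
proof -
  have U: "upset V (dual_family V (up_closure V A))"
    by (intro upset_dual_family upset_up_closure)
  have "dual_family V (up_closure V A) \<subseteq> Pow V" by (auto simp: dual_family_def)
  from Idl_sqfree_monom[OF assms(1) this] show ?thesis
    unfolding Idl_sqfree_monom[OF assms, symmetric] alexander_dual_Idl[OF assms]
      dual_family_up_closure[OF assms(2), symmetric] up_closure_upset[OF U] .
qed

lemma merge_vimage_insert: "merge_vimage V A (insert z M) = merge_vimage V A M \<union> {v \<in> V. merge A v = z}"
  by (auto simp: merge_vimage_def)

text \<open>If \<open>M\<close> is not in the merged dual, some transversal \<open>s\<close> in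
  \<open>U\<close> avoids its preimage. Were the insertions of \<open>?x\<close> and of
  \<open>?y\<close> both in the merged dual, \<open>s\<close> would contain a variable merged to
  \<open>?x\<close> and one merged to \<open>?y\<close>, hence two distinct variables over one
  index.\<close>

lemma merge_exchange_dual_family:
  assumes U: "upset V U" and tr: "transversal_generated U" and L: "merge_closed V (set L)"
  shows "merge_exchange V (dual_family V U) L"
  unfolding merge_exchange_def
proof (intro allI impI)
  fix k M
  let ?y = "L ! k" and ?A = "set (take k L)" let ?x = "(fst ?y, 1)"
  assume k: "k < length L" and M: "M \<subseteq> V" "insert ?x M \<in> merged V (dual_family V U) ?A"
    "insert ?y M \<in> merged V (dual_family V U) ?A"
  have xy: "?x \<noteq> ?y" using L nth_mem[OF k] unfolding merge_closed_def by (metis snd_conv)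
  have "V - merge_vimage V ?A M \<notin> U"
  proof
    assume "V - merge_vimage V ?A M \<in> U"
    then obtain s where s: "s \<in> U" "s \<subseteq> V - merge_vimage V ?A M" "inj_on fst s"
      using tr unfolding transversal_generated_def by blast
    \<comment> \<open>Inserting \<open>z\<close> enlarges the preimage only by the fibre over
      \<open>z\<close>, so that fibre must be met by \<open>s\<close>.\<close>
    have "\<exists>v \<in> s. merge ?A v = z" if "insert z M \<in> merged V (dual_family V U) ?A" for z
    proof (rule ccontr)
      assume "\<not> (\<exists>v \<in> s. merge ?A v = z)"
      then have sub: "s \<subseteq> V - merge_vimage V ?A (insert z M)" using s(2) by (auto simp: merge_vimage_insert)
      have "V - merge_vimage V ?A (insert z M) \<notin> U" using that by (auto simp: merged_def dual_family_def)
      with upsetD[OF U s(1) sub] show False by blast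
    qed
    from this[OF M(2)] this[OF M(3)] obtain v w where
      "v \<in> s" "w \<in> s" "merge ?A v = ?x" "merge ?A w = ?y" by blast
    moreover from this have "fst v = fst w" by (metis fst_conv fst_merge)
    ultimately have "?x = ?y" using s(3) by (metis inj_onD)
    with xy show False ..
  qed
  then show "M \<in> merged V (dual_family V U) ?A"
    using M(1) by (simp add: merged_def dual_family_def merge_vimage_subset)
qed


text \<open>A minimal member of the dual stays minimal, and keeps its size, at every stage of the
  identification. At the last stage, injectivity says that it has at most one variable over each
  index. The step uses the exchange property twice: for \<open>U\<close>, read through complements,
  and for the dual itself.\<close>

lemma minimal_dual_merge:
  assumes U: "upset V U" and tr: "transversal_generated U"
    and L: "merge_closed V (set L)" and dL: "distinct L" and ex: "merge_exchange V U L"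
    and C: "C \<in> dual_family V U" and min: "\<And>T. T \<in> dual_family V U \<Longrightarrow> \<not> T \<subset> C"
    and "k \<le> length L"
  shows "inj_on (merge (set (take k L))) C \<and>
    (\<forall>T. T \<subset> C \<longrightarrow> merge_vimage V (set (take k L)) (merge (set (take k L)) ` T) \<notin> dual_family V U)"
  using \<open>k \<le> length L\<close>
proof (induction k)
  case 0
  have "C \<subseteq> V" using C by (auto simp: dual_family_def)
  then have "merge_vimage V {} (id ` T) = T" if "T \<subset> C" for T using that by (auto simp: merge_vimage_def)
  then show ?case using min by auto
next
  case (Suc k)
  let ?D = "dual_family V U"
  let ?y = "L ! k" and ?A = "set (take k L)" let ?x = "(fst ?y, 1)"
  let ?\<pi> = "merge ?A" and ?\<pi>' = "merge (set (take (Suc k) L))"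
  let ?pre = "merge_vimage V ?A" and ?pre' = "merge_vimage V (set (take (Suc k) L))"
  have k: "k < length L" using Suc.prems by simp
  have D: "upset V ?D" by (rule upset_dual_family[OF U])
  have exD: "merge_exchange V ?D L" by (rule merge_exchange_dual_family[OF U tr L])
  have A': "set (take (Suc k) L) = insert ?y ?A" by (simp add: take_Suc_conv_app_nth[OF k])
  have yL: "?y \<in> set L" using k by simp
  have yA: "?y \<notin> ?A" using dL k by (auto simp: in_set_conv_nth nth_eq_iff_index_eq)
  have LA: "merge_closed V ?A" using merge_closed_subset[OF L] set_take_subset by metis
  have xA': "?x \<notin> insert ?y ?A"
    using L yL LA unfolding merge_closed_def by (metis insertE snd_conv)
  then have xy: "?x \<noteq> ?y" by blast
  have xV: "?x \<in> V" and yV: "?y \<in> V" using L yL by (auto simp: merge_closed_def)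
  have \<pi>': "?\<pi>' v = (if ?\<pi> v = ?y then ?x else ?\<pi> v)" for v
    unfolding A' by (rule merge_insert[OF xA' refl yA])
  have CV: "C \<subseteq> V" using C by (auto simp: dual_family_def)
  have inj: "inj_on ?\<pi> C" and IH: "\<And>T. T \<subset> C \<Longrightarrow> ?pre (?\<pi> ` T) \<notin> ?D"
    using Suc by auto
  define F where "F = ?\<pi> ` C"
  have FV: "F \<subseteq> V" using CV merge_in[OF LA] by (auto simp: F_def)
  have preF: "?pre F \<in> ?D" using CV by (intro upsetD[OF D C] merge_vimage_subset) (auto simp: F_def merge_vimage_def)
  \<comment> \<open>Minimality of the merged image \<open>F\<close>, tested on removal of one
    element.\<close>
  have del: "?pre (F - {z}) \<notin> ?D" if z: "z \<in> F" for z
  proof -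
    obtain v where v: "v \<in> C" "?\<pi> v = z" using z by (auto simp: F_def)
    then have "F - {z} = ?\<pi> ` (C - {v})" using inj by (auto simp: F_def inj_on_def)
    then show ?thesis using IH[of "C - {v}"] v(1) by auto
  qed
  \<comment> \<open>The exchange property of \<open>U\<close> after passing to complements: no
    minimal member of the merged dual contains both \<open>?x\<close> and \<open>?y\<close>.\<close>
  have E: "?pre (insert ?x N) \<in> ?D \<or> ?pre (insert ?y N) \<in> ?D"
    if N: "N \<subseteq> V" "?x \<notin> N" "?y \<notin> N" "?pre (insert ?x (insert ?y N)) \<in> ?D" for N
  proof (rule ccontr)
    assume h: "\<not> ?thesis"
    define M where "M = V - insert ?x (insert ?y N)"
    have 1: "V - ?pre (insert ?x N) = ?pre (insert ?y M)" "V - ?pre (insert ?y N) = ?pre (insert ?x M)"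
      "V - ?pre (insert ?x (insert ?y N)) = ?pre M"
      using merge_in[OF LA] N(2,3) xy xV yV by (auto simp: merge_vimage_def M_def)
    have "?pre (insert ?y M) \<in> U" "?pre (insert ?x M) \<in> U"
      using h unfolding dual_family_def 1(1,2)[symmetric] using merge_vimage_subset by blast+
    moreover have "M \<subseteq> V" by (auto simp: M_def)
    ultimately have "?pre M \<in> U" using ex k xV yV unfolding merge_exchange_def merged_def by simp
    then show False using N(4) 1(3) by (simp add: dual_family_def)
  qed
  have E': "?pre M \<in> ?D" if "M \<subseteq> V" "?pre (insert ?x M) \<in> ?D" "?pre (insert ?y M) \<in> ?D" for M
    using exD k that xV yV unfolding merge_exchange_def merged_def by simp
  \<comment> \<open>Hence the next identification cannot collapse two elements of
    \<open>F\<close>.\<close>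
  have nb: "\<not> (?x \<in> F \<and> ?y \<in> F)"
  proof
    assume h: "?x \<in> F \<and> ?y \<in> F"
    let ?N = "F - {?x, ?y}"
    have 1: "insert ?x (insert ?y ?N) = F" "insert ?x ?N = F - {?y}" "insert ?y ?N = F - {?x}"
      using h xy by auto
    have "?N \<subseteq> V" "?x \<notin> ?N" "?y \<notin> ?N" using FV by auto
    moreover have "?pre (insert ?x (insert ?y ?N)) \<in> ?D" using preF by (simp only: 1(1))
    ultimately have "?pre (F - {?y}) \<in> ?D \<or> ?pre (F - {?x}) \<in> ?D"
      using E[of ?N] by (simp only: 1(2,3) simp_thms)
    then show False using del h by blast
  qed
  have inj': "inj_on ?\<pi>' C"
  proof (rule inj_onI)
    fix v w assume vw: "v \<in> C" "w \<in> C" "?\<pi>' v = ?\<pi>' w"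
    then have "?\<pi> v \<in> F" "?\<pi> w \<in> F" by (auto simp: F_def)
    with vw(3) nb have "?\<pi> v = ?\<pi> w" by (auto simp: \<pi>' split: if_splits)
    then show "v = w" using inj vw by (auto dest: inj_onD)
  qed
  moreover have "?pre' (?\<pi>' ` T) \<notin> ?D" if T: "T \<subset> C" for T
  proof
    assume h: "?pre' (?\<pi>' ` T) \<in> ?D"
    define G where "G = ?\<pi> ` T"
    have GF: "G \<subseteq> F" using T by (auto simp: G_def F_def)
    have preG: "?pre G \<notin> ?D" using IH[OF T] by (simp add: G_def)
    have img: "?\<pi>' ` T = (\<lambda>u. if u = ?y then ?x else u) ` G" unfolding G_def image_image by (rule image_cong[OF refl \<pi>'])
    show False
    proof (cases "?x \<in> G \<or> ?y \<in> G")
      case False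
      then have "?\<pi>' ` T = G" unfolding img by (auto simp: image_iff)
      then have "?pre' (?\<pi>' ` T) = ?pre G" using False by (auto simp: merge_vimage_def \<pi>')
      with h preG show False by simp
    next
      case True
      define N where "N = G - {?x, ?y}"
      have "?\<pi>' ` T = insert ?x N" using True xy unfolding img N_def by (auto simp: image_iff)
      then have "?pre' (?\<pi>' ` T) = ?pre (insert ?x (insert ?y N))"
        by (auto simp: merge_vimage_def \<pi>' N_def split: if_splits)
      with h E[of N] FV GF have E: "?pre (insert ?x N) \<in> ?D \<or> ?pre (insert ?y N) \<in> ?D"
        by (auto simp: N_def)
      \<comment> \<open>As \<open>insert z N\<close> is \<open>G\<close>, which is not in the dual,
        the alternative \<open>E\<close> yields \<open>insert w N\<close>, and so
        \<open>insert w (F - {z})\<close>. Together with \<open>F\<close> itself, \<open>E'\<close>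
        then puts \<open>F - {z}\<close> into the dual, against minimality.\<close>
      have swap: False if z: "z \<in> G" "w \<notin> F" "{z, w} = {?x, ?y}" for z w
      proof -
        have "w \<notin> G" using z GF by blast
        then have "insert z N = G" using z by (auto simp: N_def)
        with E preG z(3) have "?pre (insert w N) \<in> ?D" by (auto simp: doubleton_eq_iff)
        moreover have sub: "insert w N \<subseteq> insert w (F - {z})" using GF z(3) by (auto simp: N_def)
        ultimately have "?pre (insert w (F - {z})) \<in> ?D"
          using upsetD[OF D _ merge_vimage_mono[OF sub] merge_vimage_subset] by metis
        moreover have "insert z (F - {z}) = F" using z GF by blast
        then have "?pre (insert z (F - {z})) \<in> ?D" using preF by simp
        ultimately have "?pre (F - {z}) \<in> ?D"
          using z(3) E'[of "F - {z}"] FV by (auto simp: doubleton_eq_iff simp del: insert_Diff_single)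
        then show False using del z(1) GF by blast
      qed
      have "{?x, ?y} = {?x, ?y}" "{?y, ?x} = {?x, ?y}" by auto
      with swap[of ?x ?y] swap[of ?y ?x] True nb GF show False by blast
    qed
  qed
  ultimately show ?case by blast
qed

section \<open>Ideals given by partitionings\<close>

text \<open>The eliminated variables in the order of \<open>pol_seq\<close>. Upper indices start at
  2, since \<open>(i, 1)\<close> is the variable that is kept.\<close>

definition pol_list :: "nat \<Rightarrow> (nat \<Rightarrow> nat) \<Rightarrow> (nat \<times> nat) list" where
  "pol_list n r = concat (map (\<lambda>i. map (Pair i) [2..<Suc (r i)]) [1..<Suc n])"

lemma pol_seq_eq_var_diffs: "pol_seq n r = var_diffs (pol_list n r)"
  by (simp add: pol_seq_def pol_list_def var_diffs_def map_concat o_def)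

lemma set_pol_list: "set (pol_list n r) = {v \<in> pol_vars n r. snd v \<noteq> 1}"
  by (force simp: pol_list_def pol_vars_def image_iff simp del: upt_Suc)

lemma distinct_pol_list: "distinct (pol_list n r)"
proof -
  have "distinct (concat (map (\<lambda>i. map (Pair i) (g i)) xs))"
    if "distinct xs" "\<And>i. distinct (g i)" for xs :: "nat list" and g :: "nat \<Rightarrow> nat list"
    using that(1) by (induction xs) (auto simp: distinct_map inj_on_def that(2))
  then show ?thesis unfolding pol_list_def by simp
qed

lemma finite_pol_vars: "finite (pol_vars n r)"
proof -
  have "pol_vars n r = (SIGMA i:{1..n}. {1..r i})" by (auto simp: pol_vars_def)
  then show ?thesis by simp
qed

lemma merge_closed_pol_list:
  assumes "\<forall>i \<in> {1..n}. 1 \<le> r i"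
  shows "merge_closed (pol_vars n r) (set (pol_list n r))"
  using assms by (auto simp: merge_closed_def set_pol_list pol_vars_def)

lemma merge_pol_list:
  assumes "v \<in> pol_vars n r"
  shows "merge (set (pol_list n r)) v = (fst v, 1)"
  using assms by (cases v) (auto simp: merge_def set_pol_list)

section \<open>Upper indices and supports of the generators given by a partitioning\<close>

definition part_index :: "(nat \<Rightarrow> nat) \<Rightarrow> (nat \<Rightarrow> nat \<Rightarrow> nat set set) \<Rightarrow> nat \<Rightarrow> nat set \<Rightarrow> nat" where
  "part_index r P i \<sigma> = (THE j. j \<in> {1..r i} \<and> \<sigma> - {i} \<in> P i j)"

definition part_support :: "(nat \<Rightarrow> nat) \<Rightarrow> (nat \<Rightarrow> nat \<Rightarrow> nat set set) \<Rightarrow> nat set \<Rightarrow> (nat \<times> nat) set" where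
  "part_support r P \<sigma> = (\<lambda>i. (i, part_index r P i \<sigma>)) ` \<sigma>"

lemma fst_part_support [simp]: "fst ` part_support r P \<sigma> = \<sigma>"
  by (simp add: part_support_def image_image)

lemma inj_on_fst_part_support: "inj_on fst (part_support r P \<sigma>)"
  by (auto simp: part_support_def inj_on_def)

lemma part_monom_eq: "part_monom r P \<sigma> = sqfree_monom (part_support r P \<sigma>)"
  unfolding part_monom_def sqfree_monom_def part_support_def part_index_def
  by (subst prod.reindex) (auto simp: inj_on_def)

lemma part_index_bounds:
  assumes P: "partitionings n d r P" and \<sigma>: "\<sigma> \<in> Gam n d" and i: "i \<in> \<sigma>"
  shows "part_index r P i \<sigma> \<in> {1..r i}"
proof -
  have i': "i \<in> {1..n}" using \<sigma> i by (auto simp: Gam_def)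
  have "finite \<sigma>" using \<sigma> finite_subset[of \<sigma> "{1..n}"] by (auto simp: Gam_def)
  then have "\<sigma> - {i} \<in> Sig n d i" using \<sigma> i by (auto simp: Sig_def Gam_def)
  then obtain j where j: "j \<in> {1..r i}" "\<sigma> - {i} \<in> P i j"
    using P i' unfolding partitionings_def by blast
  have "j' = j" if "j' \<in> {1..r i} \<and> \<sigma> - {i} \<in> P i j'" for j'
    using P i' j that unfolding partitionings_def disjoint_family_on_def by blast
  then have "part_index r P i \<sigma> = j"
    unfolding part_index_def using j by (intro the_equality) auto
  then show ?thesis using j by simp
qed

lemma part_support_subset:
  assumes "partitionings n d r P" "\<sigma> \<in> Gam n d"
  shows "part_support r P \<sigma> \<subseteq> pol_vars n r"
  using part_index_bounds[OF assms] assms(2) by (auto simp: part_support_def pol_vars_def Gam_def)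

lemma part_ideal_eq:
  assumes "partitionings n d r P"
  shows "part_ideal n d r P =
    support_ideal (pol_vars n r) (up_closure (pol_vars n r) (part_support r P ` Gam n d))"
proof -
  have "part_monom r P ` Gam n d = (sqfree_monom ` part_support r P ` Gam n d :: (nat \<times> nat, 'a::field) mpol set)"
    by (simp add: image_image part_monom_eq)
  then show ?thesis
    unfolding part_ideal_def using part_support_subset[OF assms]
    by (simp add: Idl_sqfree_monom[OF finite_pol_vars] image_subset_iff)
qed

lemma transversal_generated_part:
  assumes "partitionings n d r P"
  shows "transversal_generated (up_closure (pol_vars n r) (part_support r P ` Gam n d))"
  unfolding transversal_generated_def
proof
  fix M assume "M \<in> up_closure (pol_vars n r) (part_support r P ` Gam n d)"
  then obtain \<sigma> where "\<sigma> \<in> Gam n d" "part_support r P \<sigma> \<subseteq> M" by (auto simp: up_closure_def)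
  then show "\<exists>s \<in> up_closure (pol_vars n r) (part_support r P ` Gam n d). s \<subseteq> M \<and> inj_on fst s"
    using part_support_subset[OF assms] inj_on_fst_part_support
    by (intro bexI[of _ "part_support r P \<sigma>"]) (auto simp: up_closure_def)
qed

text \<open>A set of size \<open>d\<close> avoids \<open>F\<close> iff it fits into the complement,
  which has \<open>n - card F\<close> elements.\<close>

lemma meets_all_Gam_iff:
  assumes "d \<le> n" "F \<subseteq> {1..n}"
  shows "(\<forall>\<sigma> \<in> Gam n d. F \<inter> \<sigma> \<noteq> {}) \<longleftrightarrow> n - d + 1 \<le> card F"
proof -
  have fin: "finite F" using assms(2) finite_subset by blast
  have cF: "card ({1..n} - F) = n - card F" "card F \<le> n"
    using assms(2) card_Diff_subset[OF fin assms(2)] card_mono[OF _ assms(2)] by auto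
  show ?thesis
  proof
    assume h: "\<forall>\<sigma> \<in> Gam n d. F \<inter> \<sigma> \<noteq> {}"
    show "n - d + 1 \<le> card F"
    proof (rule ccontr)
      assume "\<not> ?thesis"
      then have "d \<le> card ({1..n} - F)" using cF assms(1) by linarith
      then obtain \<sigma> where "\<sigma> \<subseteq> {1..n} - F" "card \<sigma> = d" by (meson obtain_subset_with_card_n)
      with h show False by (auto simp: Gam_def)
    qed
  next
    assume h: "n - d + 1 \<le> card F"
    show "\<forall>\<sigma> \<in> Gam n d. F \<inter> \<sigma> \<noteq> {}"
    proof
      fix \<sigma> assume \<sigma>: "\<sigma> \<in> Gam n d"
      show "F \<inter> \<sigma> \<noteq> {}"
      proof
        assume "F \<inter> \<sigma> = {}"
        then have "\<sigma> \<subseteq> {1..n} - F" using \<sigma> by (auto simp: Gam_def)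
        from card_mono[OF _ this] have "d \<le> n - card F" using \<sigma> cF by (simp add: Gam_def)
        then show False using h cF assms(1) by linarith
      qed
    qed
  qed
qed

lemma dual_family_Gam:
  assumes "d \<le> n"
  shows "dual_family {1..n} (up_closure {1..n} (Gam n d)) = up_closure {1..n} (Gam n (n - d + 1))"
proof -
  have "Gam n d \<subseteq> Pow {1..n}" by (auto simp: Gam_def)
  then have "dual_family {1..n} (up_closure {1..n} (Gam n d)) = {T. T \<subseteq> {1..n} \<and> n - d + 1 \<le> card T}"
    using meets_all_Gam_iff[OF assms] by (subst dual_family_up_closure) blast+
  also have "\<dots> = up_closure {1..n} (Gam n (n - d + 1))"
  proof -
    have "(\<exists>\<sigma> \<in> Gam n (n - d + 1). \<sigma> \<subseteq> T) \<longleftrightarrow> n - d + 1 \<le> card T" if T: "T \<subseteq> {1..n}" for T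
    proof
      assume "\<exists>\<sigma> \<in> Gam n (n - d + 1). \<sigma> \<subseteq> T"
      then obtain \<sigma> where "card \<sigma> = n - d + 1" "\<sigma> \<subseteq> T" by (auto simp: Gam_def)
      with card_mono[OF finite_subset[OF T finite_atLeastAtMost], of \<sigma>] show "n - d + 1 \<le> card T" by simp
    next
      assume "n - d + 1 \<le> card T"
      then obtain \<sigma> where "\<sigma> \<subseteq> T" "card \<sigma> = n - d + 1" by (meson obtain_subset_with_card_n)
      with T show "\<exists>\<sigma> \<in> Gam n (n - d + 1). \<sigma> \<subseteq> T" by (auto simp: Gam_def)
    qed
    then show ?thesis by (auto simp: up_closure_def)
  qed
  finally show ?thesis .
qed

lemma sqfree_ideal_eq: "sqfree_ideal n d = support_ideal {1..n} (up_closure {1..n} (Gam n d))"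
  unfolding sqfree_ideal_def by (rule Idl_sqfree_monom) (auto simp: Gam_def)

lemma alexander_dual_sqfree_ideal:
  assumes "d \<le> n"
  shows "alexander_dual {1..n} (sqfree_ideal n d :: (nat, 'k::field) mpol set) = sqfree_ideal n (n - d + 1)"
proof -
  have "Gam n d \<subseteq> Pow {1..n}" by (auto simp: Gam_def)
  from alexander_dual_support_ideal[OF finite_atLeastAtMost this] show ?thesis
    by (simp only: sqfree_ideal_eq dual_family_Gam[OF assms])
qed

text \<open>The complement of \<open>\<tau> - {i}\<close> in \<open>{1..n} - {i}\<close> is
  \<open>{1..n} - \<tau>\<close>. So the dual generator over \<open>\<tau>\<close> has the same
  variable over \<open>i\<close> as the original generator over
  \<open>insert i ({1..n} - \<tau>)\<close>.\<close>

lemma part_index_dual: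
  assumes \<tau>: "\<tau> \<in> Gam n (n - d + 1)" and i: "i \<in> \<tau>"
  shows "part_index r (dual_part n d P) i \<tau> = part_index r P i (insert i ({1..n} - \<tau>))"
proof -
  have "finite \<tau>" using \<tau> finite_subset[of \<tau> "{1..n}"] by (auto simp: Gam_def)
  then have "card (\<tau> - {i}) = n - d" using \<tau> i by (simp add: Gam_def)
  moreover have "{1..n} - (\<tau> - {i} \<union> {i}) = {1..n} - \<tau>" "insert i ({1..n} - \<tau>) - {i} = {1..n} - \<tau>"
    using i by auto
  ultimately have "\<tau> - {i} \<in> dual_part n d P i j \<longleftrightarrow> insert i ({1..n} - \<tau>) - {i} \<in> P i j" for j
    using \<tau> by (auto simp: dual_part_def Gam_def)
  then show ?thesis by (simp add: part_index_def)
qed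

lemma insert_compl_in_Gam:
  assumes "d \<le> n" "1 \<le> d" "\<tau> \<in> Gam n (n - d + 1)" "i \<in> \<tau>"
  shows "insert i ({1..n} - \<tau>) \<in> Gam n d"
proof -
  have "finite \<tau>" using assms(3) finite_subset[of \<tau> "{1..n}"] by (auto simp: Gam_def)
  \<comment> \<open>This number is \<open>d - 1\<close>; adding \<open>i\<close> gives
    \<open>d\<close>.\<close>
  then have "card ({1..n} - \<tau>) = n - (n - d + 1)"
    using assms(3) by (subst card_Diff_subset) (auto simp: Gam_def)
  then show ?thesis using assms by (auto simp: Gam_def card_insert_if)
qed

text \<open>Complementation in \<open>{1..n} - {i}\<close> is a bijection between
  \<open>Sig n (n - d + 1) i\<close> and \<open>Sig n d i\<close>, and the dual blocks are its
  preimages of the blocks.\<close>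

lemma partitionings_dual_part:
  assumes d: "1 \<le> d" "d \<le> n" and P: "partitionings n d r P"
  shows "partitionings n (n - d + 1) r (dual_part n d P)"
  unfolding partitionings_def
proof (intro ballI conjI)
  fix i assume i: "i \<in> {1..n}"
  have Pi: "disjoint_family_on (P i) {1..r i}" "(\<Union>j \<in> {1..r i}. P i j) = Sig n d i"
    "\<And>j. j \<in> {1..r i} \<Longrightarrow> P i j \<noteq> {}" using P i by (auto simp: partitionings_def)
  show "disjoint_family_on (dual_part n d P i) {1..r i}"
    using Pi(1) unfolding disjoint_family_on_def dual_part_def by blast
  have co: "card ({1..n} - (\<sigma> \<union> {i})) = n - Suc (card \<sigma>)" if "\<sigma> \<subseteq> {1..n}" "i \<notin> \<sigma>" for \<sigma>
  proof -
    have "finite \<sigma>" using that(1) finite_subset by blast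
    then show ?thesis using that i by (subst card_Diff_subset) auto
  qed
  have mem: "{1..n} - (\<sigma> \<union> {i}) \<in> Sig n d i" if "\<sigma> \<in> Sig n (n - d + 1) i" for \<sigma>
    using that co[of \<sigma>] d by (auto simp: Sig_def Gam_def)
  show "(\<Union>j \<in> {1..r i}. dual_part n d P i j) = Sig n (n - d + 1) i"
  proof
    show "(\<Union>j \<in> {1..r i}. dual_part n d P i j) \<subseteq> Sig n (n - d + 1) i"
      by (auto simp: dual_part_def Sig_def Gam_def)
    show "Sig n (n - d + 1) i \<subseteq> (\<Union>j \<in> {1..r i}. dual_part n d P i j)"
    proof
      fix \<sigma> assume \<sigma>: "\<sigma> \<in> Sig n (n - d + 1) i"
      from mem[OF this] obtain j where "j \<in> {1..r i}" "{1..n} - (\<sigma> \<union> {i}) \<in> P i j"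
        using Pi(2) by blast
      with \<sigma> show "\<sigma> \<in> (\<Union>j \<in> {1..r i}. dual_part n d P i j)"
        by (auto simp: dual_part_def Sig_def Gam_def)
    qed
  qed
  fix j assume j: "j \<in> {1..r i}"
  then obtain \<rho> where \<rho>: "\<rho> \<in> P i j" using Pi(3) by blast
  then have S: "\<rho> \<in> Sig n d i" using Pi(2) j by blast
  let ?\<sigma> = "{1..n} - (\<rho> \<union> {i})"
  have "{1..n} - (?\<sigma> \<union> {i}) = \<rho>" using S by (auto simp: Sig_def Gam_def)
  then have "?\<sigma> \<in> dual_part n d P i j"
    using \<rho> S co[of \<rho>] d by (auto simp: dual_part_def Sig_def Gam_def)
  then show "dual_part n d P i j \<noteq> {}" by blast
qed

text \<open>Both inclusions go through the minimal members of the dual: each is the support of a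
  dual generator, and each dual generator arises in this way from a minimal member below the full
  fibre over \<open>\<tau>\<close>.\<close>

lemma dual_family_part:
  assumes d: "1 \<le> d" "d \<le> n" and P: "partitionings n d r P" and r: "\<forall>i \<in> {1..n}. 1 \<le> r i"
    and ex: "merge_exchange (pol_vars n r) (up_closure (pol_vars n r) (part_support r P ` Gam n d)) (pol_list n r)"
  shows "dual_family (pol_vars n r) (up_closure (pol_vars n r) (part_support r P ` Gam n d))
    = up_closure (pol_vars n r) (part_support r (dual_part n d P) ` Gam n (n - d + 1))"
proof -
  let ?V = "pol_vars n r" and ?U = "up_closure (pol_vars n r) (part_support r P ` Gam n d)"
  let ?D = "dual_family ?V ?U" and ?L = "pol_list n r" and ?Q = "dual_part n d P"
  have U: "upset ?V ?U" by (rule upset_up_closure)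
  have D: "upset ?V ?D" by (rule upset_dual_family[OF U])
  have sub: "part_support r P ` Gam n d \<subseteq> Pow ?V" using part_support_subset[OF P] by auto
  have D_iff: "T \<in> ?D \<longleftrightarrow> T \<subseteq> ?V \<and> (\<forall>\<sigma> \<in> Gam n d. T \<inter> part_support r P \<sigma> \<noteq> {})" for T
    unfolding dual_family_up_closure[OF sub] by auto
  have fsub: "fst ` T \<subseteq> {1..n}" if "T \<subseteq> ?V" for T using that by (auto simp: pol_vars_def)
  \<comment> \<open>A full fibre meets the generator over \<open>\<sigma>\<close> iff
    \<open>F\<close> meets \<open>\<sigma>\<close>, whatever the upper indices are.\<close>
  have fiber: "{v \<in> ?V. fst v \<in> F} \<in> ?D \<longleftrightarrow> n - d + 1 \<le> card F" if "F \<subseteq> {1..n}" for F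
  proof -
    have "{v \<in> ?V. fst v \<in> F} \<inter> part_support r P \<sigma> \<noteq> {} \<longleftrightarrow> F \<inter> \<sigma> \<noteq> {}" if "\<sigma> \<in> Gam n d" for \<sigma>
    proof -
      have "(i, part_index r P i \<sigma>) \<in> ?V" if "i \<in> \<sigma>" for i
        using part_support_subset[OF P \<open>\<sigma> \<in> _\<close>] that by (auto simp: part_support_def)
      then show ?thesis by (fastforce simp: part_support_def)
    qed
    then show ?thesis using meets_all_Gam_iff[OF d(2) that] by (auto simp: D_iff)
  qed
  have min: "fst ` C \<in> Gam n (n - d + 1) \<and> C = part_support r ?Q (fst ` C)"
    if C: "C \<in> ?D" and mC: "\<And>T. T \<in> ?D \<Longrightarrow> \<not> T \<subset> C" for C
  proof -
    let ?\<tau> = "fst ` C"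
    have CV: "C \<subseteq> ?V" using C by (simp add: D_iff)
    \<comment> \<open>Once all identifications are made, the preimage of an image is the full fibre
      over the indices that occur.\<close>
    have merge_vimage: "merge_vimage ?V (set ?L) (merge (set ?L) ` T) = {v \<in> ?V. fst v \<in> fst ` T}" if "T \<subseteq> ?V" for T
      using that by (force simp: merge_vimage_def merge_pol_list image_iff)
    from minimal_dual_merge[OF U transversal_generated_part[OF P] merge_closed_pol_list[OF r]
        distinct_pol_list ex C mC, of "length ?L"]
    have inj: "inj_on (merge (set ?L)) C"
      and no: "\<And>T. T \<subset> C \<Longrightarrow> {v \<in> ?V. fst v \<in> fst ` T} \<notin> ?D"
      using merge_vimage CV by auto
    have injf: "inj_on fst C"
      using inj CV by (simp add: inj_on_def merge_pol_list[OF subsetD[OF CV]])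
    have "{v \<in> ?V. fst v \<in> ?\<tau>} \<in> ?D" using CV by (intro upsetD[OF D C]) auto
    then have ge: "n - d + 1 \<le> card ?\<tau>" using fiber[OF fsub[OF CV]] by simp
    then obtain v where v: "v \<in> C" by (metis card.empty ex_in_conv image_is_empty not_less_eq_eq zero_le Suc_eq_plus1)
    have finC: "finite C" by (rule finite_subset[OF CV finite_pol_vars])
    \<comment> \<open>Dropping one variable leaves fewer than \<open>n - d + 1\<close> indices, so
      \<open>C\<close> lies over exactly \<open>n - d + 1\<close> of them.\<close>
    have "C - {v} \<subset> C" "fst ` (C - {v}) \<subseteq> {1..n}" using v fsub CV by auto
    then have "\<not> n - d + 1 \<le> card (fst ` (C - {v}))" using no[of "C - {v}"] fiber by blast
    moreover have "card (fst ` (C - {v})) = card ?\<tau> - 1"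
      using injf v finC by (simp add: card_image inj_on_diff)
    ultimately have \<tau>: "?\<tau> \<in> Gam n (n - d + 1)" using ge fsub[OF CV] by (auto simp: Gam_def)
    have "part_support r ?Q ?\<tau> \<subseteq> C"
    proof
      fix w assume "w \<in> part_support r ?Q ?\<tau>"
      then obtain i where i: "i \<in> ?\<tau>" "w = (i, part_index r ?Q i ?\<tau>)" by (auto simp: part_support_def)
      \<comment> \<open>It meets \<open>?\<tau>\<close> only in \<open>i\<close>, so
        \<open>C\<close> can meet the generator over \<open>?\<sigma>\<close> only in the variable
        of that generator over \<open>i\<close>.\<close>
      let ?\<sigma> = "insert i ({1..n} - ?\<tau>)"
      have "?\<sigma> \<in> Gam n d" by (rule insert_compl_in_Gam[OF d(2,1) \<tau> i(1)])
      then obtain u where u: "u \<in> C" "u \<in> part_support r P ?\<sigma>" using C[unfolded D_iff] by blast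
      have "fst u \<in> ?\<sigma>" using imageI[OF u(2), of fst] by (simp only: fst_part_support)
      moreover have "fst u \<in> ?\<tau>" using u(1) by (rule imageI)
      ultimately have "fst u = i" by blast
      moreover have "u = (fst u, part_index r P (fst u) ?\<sigma>)"
        using u(2) unfolding part_support_def by (elim imageE) simp
      ultimately have "u = (i, part_index r P i ?\<sigma>)" by simp
      then show "w \<in> C" using u(1) i(2) part_index_dual[OF \<tau> i(1), of r P] by simp
    qed
    moreover have "C \<subseteq> part_support r ?Q ?\<tau>"
    proof
      fix u assume u: "u \<in> C"
      then have "fst u \<in> fst ` part_support r ?Q ?\<tau>" by simp
      then obtain w where w: "fst u = fst w" "w \<in> part_support r ?Q ?\<tau>" by (rule imageE)
      then have "w \<in> C" using \<open>part_support r ?Q ?\<tau> \<subseteq> C\<close> by blast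
      with w(1) u have "u = w" by (rule inj_onD[OF injf])
      with w show "u \<in> part_support r ?Q ?\<tau>" by simp
    qed
    ultimately show ?thesis using \<tau> by blast
  qed
  have minex: "\<exists>C \<in> ?D. C \<subseteq> T \<and> (\<forall>T' \<in> ?D. \<not> T' \<subset> C)" if "T \<in> ?D" for T
  proof -
    have "?D \<subseteq> Pow ?V" using upset_subset[OF D] by blast
    then have "finite ?D" by (rule finite_subset) (simp add: finite_pol_vars)
    from finite_has_minimal2[OF this that] obtain C
      where C: "C \<in> ?D" "C \<subseteq> T" "\<forall>T' \<in> ?D. T' \<subseteq> C \<longrightarrow> C = T'" by (elim bexE conjE)
    then have "\<not> T' \<subset> C" if "T' \<in> ?D" for T' using that by (metis psubsetE subset_refl)
    with C(1,2) show ?thesis by (intro bexI[of _ C] conjI ballI)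
  qed
  show ?thesis
  proof
    show "?D \<subseteq> up_closure ?V (part_support r ?Q ` Gam n (n - d + 1))"
    proof
      fix T assume T: "T \<in> ?D"
      from minex[OF T] obtain C where C: "C \<in> ?D" "C \<subseteq> T" "\<forall>T' \<in> ?D. \<not> T' \<subset> C"
        by (elim bexE conjE)
      from min[OF C(1) C(3)[rule_format]] have "\<exists>\<tau> \<in> Gam n (n - d + 1). part_support r ?Q \<tau> \<subseteq> T"
        using C(2) by metis
      then show "T \<in> up_closure ?V (part_support r ?Q ` Gam n (n - d + 1))"
        using upset_subset[OF D T] unfolding up_closure_def by blast
    qed
    show "up_closure ?V (part_support r ?Q ` Gam n (n - d + 1)) \<subseteq> ?D"
    proof
      fix T assume "T \<in> up_closure ?V (part_support r ?Q ` Gam n (n - d + 1))"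
      then obtain \<tau> where T: "\<tau> \<in> Gam n (n - d + 1)" "part_support r ?Q \<tau> \<subseteq> T" "T \<subseteq> ?V"
        by (auto simp: up_closure_def)
      \<comment> \<open>A minimal member below this fibre lies over a subset of
        \<open>\<tau>\<close> of the same size, hence over \<open>\<tau>\<close>, and must be the
        generator sought.\<close>
      have "{v \<in> ?V. fst v \<in> \<tau>} \<in> ?D" using fiber[of \<tau>] T(1) by (auto simp: Gam_def)
      from minex[OF this] obtain C where C: "C \<in> ?D" "C \<subseteq> {v \<in> ?V. fst v \<in> \<tau>}"
        "\<forall>T' \<in> ?D. \<not> T' \<subset> C" by (elim bexE conjE)
      note m = min[OF C(1) C(3)[rule_format]]
      have "fst ` C \<subseteq> \<tau>" using C(2) by auto
      moreover have "finite \<tau>" using T(1) finite_subset[of \<tau> "{1..n}"] by (auto simp: Gam_def)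
      ultimately have "fst ` C = \<tau>" using m T(1) by (intro card_subset_eq) (auto simp: Gam_def)
      with m C(1) have "part_support r ?Q \<tau> \<in> ?D" by simp
      then show "T \<in> ?D" using upsetD[OF D] T(2,3) by blast
    qed
  qed
qed

section \<open>Image and kernel of the substitution that removes upper indices\<close>

lemma depol_part_ideal:
  assumes P: "partitionings n d r P" and r: "\<forall>i \<in> {1..n}. 1 \<le> r i"
  shows "depol ` (part_ideal n d r P :: (nat \<times> nat, 'k::field) mpol set) = sqfree_ideal n d"
proof -
  let ?V = "pol_vars n r" and ?U = "up_closure (pol_vars n r) (part_support r P ` Gam n d)"
  let ?W = "up_closure {1..n} (Gam n d)"
  have U: "upset ?V ?U" and W: "upset {1..n} ?W" by (rule upset_up_closure)+
  have J: "ideal (support_ideal ?V ?U :: (nat \<times> nat, 'k) mpol set) (mpoly_ring ?V)"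
    by (rule ideal_support_ideal[OF U])
  show ?thesis unfolding part_ideal_eq[OF P] sqfree_ideal_eq depol_eq_relab
  proof
    show "relab fst ` (support_ideal ?V ?U :: (nat \<times> nat, 'k) mpol set) \<subseteq> support_ideal {1..n} ?W"
    proof
      fix q :: "(nat, 'k) mpol" assume "q \<in> relab fst ` support_ideal ?V ?U"
      then obtain p where p: "p \<in> support_ideal ?V ?U" "q = relab fst p" by blast
      show "q \<in> support_ideal {1..n} ?W" unfolding support_ideal_iff[OF W]
      proof
        fix m assume "m \<in> Poly_Mapping.keys q"
        then obtain m' where m': "m' \<in> Poly_Mapping.keys p" "m = push fst m'"
          using keys_relab[of fst p] p(2) by auto
        then have "Poly_Mapping.keys m' \<in> ?U" using p(1) by (simp add: support_ideal_iff[OF U])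
        then obtain \<sigma> where "\<sigma> \<in> Gam n d" "part_support r P \<sigma> \<subseteq> Poly_Mapping.keys m'"
          "Poly_Mapping.keys m' \<subseteq> ?V" by (auto simp: up_closure_def)
        then show "Poly_Mapping.keys m \<in> ?W"
          using image_mono[of "part_support r P \<sigma>" "Poly_Mapping.keys m'" fst]
          by (auto simp: m'(2) keys_push up_closure_def pol_vars_def)
      qed
    qed
    show "support_ideal {1..n} ?W \<subseteq> relab fst ` (support_ideal ?V ?U :: (nat \<times> nat, 'k) mpol set)"
    proof
      fix q :: "(nat, 'k) mpol" assume q: "q \<in> support_ideal {1..n} ?W"
      have "\<exists>a. Poly_Mapping.keys a \<in> ?U \<and> push fst a = m" if m: "m \<in> Poly_Mapping.keys q" for m
      proof -
        have "Poly_Mapping.keys m \<in> ?W" using q m unfolding support_ideal_iff[OF W] by blast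
        then obtain \<sigma> where \<sigma>: "\<sigma> \<in> Gam n d" "\<sigma> \<subseteq> Poly_Mapping.keys m" "Poly_Mapping.keys m \<subseteq> {1..n}"
          by (auto simp: up_closure_def)
        \<comment> \<open>A lift of \<open>m\<close>: over \<open>\<sigma>\<close> it uses the
          indices of the generator, elsewhere the index 1, which is available since
          \<open>1 \<le> r i\<close>.\<close>
        let ?g = "\<lambda>i. (i, if i \<in> \<sigma> then part_index r P i \<sigma> else 1)"
        have "push fst (push ?g m) = m"
          unfolding push_push by (induction m rule: poly_mapping_nat_induct) (simp_all add: push_add push_single)
        moreover have "part_support r P \<sigma> \<subseteq> Poly_Mapping.keys (push ?g m)"
          using \<sigma>(2) by (auto simp: keys_push part_support_def)
        moreover have "Poly_Mapping.keys (push ?g m) \<subseteq> ?V"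
          using \<sigma>(3) r part_index_bounds[OF P \<sigma>(1)] by (auto simp: keys_push pol_vars_def)
        ultimately show ?thesis using \<sigma>(1) by (intro exI[of _ "push ?g m"]) (auto simp: up_closure_def)
      qed
      then obtain a where a: "\<And>m. m \<in> Poly_Mapping.keys q \<Longrightarrow> Poly_Mapping.keys (a m) \<in> ?U \<and> push fst (a m) = m"
        by metis
      let ?p = "\<Sum>m \<in> Poly_Mapping.keys q. Poly_Mapping.single (a m) (Poly_Mapping.lookup q m)"
      have "?p \<in> support_ideal ?V ?U"
        by (intro mpoly_ideal_sum[OF J] single_in_support_ideal[OF U]) (rule conjunct1[OF a])
      moreover have "q = relab fst ?p"
      proof -
        have "q = (\<Sum>m \<in> Poly_Mapping.keys q. Poly_Mapping.single m (Poly_Mapping.lookup q m))"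
          by (rule poly_mapping_sum_keys[OF finite_keys order_refl])
        also have "\<dots> = (\<Sum>m \<in> Poly_Mapping.keys q. Poly_Mapping.single (push fst (a m)) (Poly_Mapping.lookup q m))"
          using a by (intro sum.cong refl) metis
        finally show ?thesis by (simp only: relab_sum relab_single)
      qed
      ultimately show "q \<in> relab fst ` support_ideal ?V ?U" by (rule rev_image_eqI)
    qed
  qed
qed

text \<open>On the variables in question the complete identification is \<open>depol\<close>
  followed by \<open>i \<mapsto> (i, 1)\<close>. So an element of \<open>J\<close> killed by
  \<open>depol\<close> lies in the ideal of the differences, and regularity moves it into the
  product.\<close>

lemma depol_kernel:
  fixes J :: "(nat \<times> nat, 'k::field) mpol set"
  assumes r: "\<forall>i \<in> {1..n}. 1 \<le> r i" and J: "ideal J (mpoly_ring (pol_vars n r))"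
    and reg: "\<forall>i < length (pol_seq n r :: (nat \<times> nat, 'k) mpol list). \<forall>a \<in> carrier (mpoly_ring (pol_vars n r)).
        pol_seq n r ! i * a \<in> ideal_sum_seq (pol_vars n r) J (take i (pol_seq n r)) \<longrightarrow>
        a \<in> ideal_sum_seq (pol_vars n r) J (take i (pol_seq n r))"
  shows "{f \<in> J. depol f = 0} = (Idl\<^bsub>mpoly_ring (pol_vars n r)\<^esub> (set (pol_seq n r))) \<cdot>\<^bsub>mpoly_ring (pol_vars n r)\<^esub> J"
proof -
  let ?V = "pol_vars n r" and ?L = "pol_list n r"
  let ?R = "mpoly_ring ?V :: (nat \<times> nat, 'k) mpol ring"
  interpret cring ?R by (rule cring_mpoly_ring)
  have L: "merge_closed ?V (set ?L)" by (rule merge_closed_pol_list[OF r])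
  have fs: "set (pol_seq n r) \<subseteq> carrier ?R" unfolding pol_seq_eq_var_diffs by (rule var_diffs_closed[OF L])
  show ?thesis
  proof
    have "f \<in> J \<inter> seq_span ?V (pol_seq n r)" if f: "f \<in> J" "depol f = 0" for f
    proof -
      have fc: "f \<in> carrier ?R" by (rule mpoly_ideal_carrier[OF J f(1)])
      have "relab (merge (set ?L)) f = relab (\<lambda>v. (fst v, 1)) f"
        unfolding relab_eq[OF finite_keys order_refl]
      proof (rule sum.cong[OF refl])
        fix m assume "m \<in> Poly_Mapping.keys f"
        then have "Poly_Mapping.keys m \<subseteq> ?V" using fc by (simp add: mem_carrier_mpoly_ring)
        then have "push (merge (set ?L)) m = push (\<lambda>v. (fst v, 1)) m"
          unfolding push_def by (intro sum.cong refl) (simp only: merge_pol_list subsetD)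
        then show "Poly_Mapping.single (push (merge (set ?L)) m) (Poly_Mapping.lookup f m)
          = Poly_Mapping.single (push (\<lambda>v. (fst v, 1)) m) (Poly_Mapping.lookup f m)" by simp
      qed
      also have "\<dots> = relab (\<lambda>i. (i, 1)) (relab fst f)" by (simp add: relab_relab)
      also have "\<dots> = 0" using f(2) by (simp add: depol_eq_relab)
      finally show ?thesis
        using relab_merge_diff[OF L fc] f(1) by (simp add: pol_seq_eq_var_diffs)
    qed
    then show "{f \<in> J. depol f = 0} \<subseteq> (Idl\<^bsub>?R\<^esub> (set (pol_seq n r))) \<cdot>\<^bsub>?R\<^esub> J"
      using regular_sequence_inter[OF J fs reg] by blast
    have "(Idl\<^bsub>?R\<^esub> (set (pol_seq n r))) \<cdot>\<^bsub>?R\<^esub> J \<subseteq> seq_span ?V (pol_seq n r) \<inter> J"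
      using ideal_prod_inter[OF genideal_ideal[OF fs] J] by (simp add: Idl_set_eq_seq_span(1)[OF fs])
    then show "(Idl\<^bsub>?R\<^esub> (set (pol_seq n r))) \<cdot>\<^bsub>?R\<^esub> J \<subseteq> {f \<in> J. depol f = 0}"
      unfolding depol_eq_relab pol_seq_eq_var_diffs using relab_seq_span[of ?L fst] by fastforce
  qed
qed

theorem theorem3p5:
  fixes n d :: nat and r :: "nat \<Rightarrow> nat" and P :: "nat \<Rightarrow> nat \<Rightarrow> nat set set"
    and It :: "(nat \<times> nat, 'k::field) mpol set"
  assumes "1 \<le> d" and "d \<le> n"
    and "is_polarization n r It (sqfree_ideal n d)"
    and "partitionings n d r P" and "It = part_ideal n d r P"
  shows "alexander_dual {1..n} (sqfree_ideal n d :: (nat, 'k) mpol set) = sqfree_ideal n (n - d + 1)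
    \<and> is_polarization n r (alexander_dual (pol_vars n r) It)
        (alexander_dual {1..n} (sqfree_ideal n d))
    \<and> partitionings n (n - d + 1) r (dual_part n d P)
    \<and> alexander_dual (pol_vars n r) It = part_ideal n (n - d + 1) r (dual_part n d P)"
proof -
  note d = assms(1,2) and P = assms(4) and It = assms(5)
  let ?V = "pol_vars n r" and ?L = "pol_list n r" and ?Q = "dual_part n d P"
  let ?R = "mpoly_ring ?V :: (nat \<times> nat, 'k) mpol ring"
  let ?A = "part_support r P ` Gam n d" and ?B = "part_support r ?Q ` Gam n (n - d + 1)"
  let ?U = "up_closure ?V ?A" and ?W = "up_closure ?V ?B"
  note pol = assms(3)[unfolded is_polarization_def Let_def]
  have r: "\<forall>i \<in> {1..n}. 1 \<le> r i" using pol by blast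
  have L: "merge_closed ?V (set ?L)" by (rule merge_closed_pol_list[OF r])
  have fs: "set (pol_seq n r) \<subseteq> carrier ?R" unfolding pol_seq_eq_var_diffs by (rule var_diffs_closed[OF L])
  have Q: "partitionings n (n - d + 1) r ?Q" by (rule partitionings_dual_part[OF d P])
  have U: "upset ?V ?U" and W: "upset ?V ?W" by (rule upset_up_closure)+
  have I: "ideal (support_ideal ?V ?U :: (nat \<times> nat, 'k) mpol set) ?R"
    and J: "ideal (support_ideal ?V ?W :: (nat \<times> nat, 'k) mpol set) ?R"
    by (intro ideal_support_ideal U W)+
  have trU: "transversal_generated ?U" and trW: "transversal_generated ?W"
    by (intro transversal_generated_part P Q)+
  have "regular_sequence ?R (quot_module ?R (support_ideal ?V ?U)) (pol_seq n r)"
    using pol unfolding It part_ideal_eq[OF P] by blast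
  \<comment> \<open>All that is needed from the given polarization besides
    \<open>1 \<le> r i\<close>: regularity in its combinatorial form.\<close>
  then have ex: "merge_exchange ?V ?U ?L"
    unfolding regular_sequence_iff[OF I fs] unfolding pol_seq_eq_var_diffs
      regular_var_diffs_iff[OF U finite_pol_vars trU L distinct_pol_list] by blast
  have D: "dual_family ?V ?U = ?W" by (rule dual_family_part[OF d P r ex])
  have dual: "alexander_dual ?V It = support_ideal ?V ?W"
    unfolding It part_ideal_eq[OF P] D[symmetric]
    using part_support_subset[OF P] by (intro alexander_dual_support_ideal finite_pol_vars) blast
  \<comment> \<open>Regularity for the dual comes from the shape of the generators of the given
    ideal, not from its regularity.\<close>
  have "merge_exchange ?V ?W ?L"
    unfolding D[symmetric] by (rule merge_exchange_dual_family[OF U trU L])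
  then have reg: "\<forall>i < length (pol_seq n r :: (nat \<times> nat, 'k) mpol list). \<forall>a \<in> carrier ?R.
      pol_seq n r ! i * a \<in> ideal_sum_seq ?V (support_ideal ?V ?W) (take i (pol_seq n r)) \<longrightarrow>
      a \<in> ideal_sum_seq ?V (support_ideal ?V ?W) (take i (pol_seq n r))"
    unfolding pol_seq_eq_var_diffs regular_var_diffs_iff[OF W finite_pol_vars trW L distinct_pol_list] .
  have one: "1 \<in> carrier ?R" by (simp add: mem_carrier_mpoly_ring)
  \<comment> \<open>Properness: otherwise the empty set would belong to \<open>?W\<close>, but each
    generator lies over \<open>n - d + 1 \<ge> 1\<close> indices.\<close>
  have "(1 :: (nat \<times> nat, 'k) mpol) \<notin> ideal_sum_seq ?V (support_ideal ?V ?W) (pol_seq n r)"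
  proof
    assume "1 \<in> ideal_sum_seq ?V (support_ideal ?V ?W :: (nat \<times> nat, 'k) mpol set) (pol_seq n r)"
    then have "relab (merge (set ?L)) 1 \<in> (support_ideal ?V (merged ?V ?W (set ?L)) :: (nat \<times> nat, 'k) mpol set)"
      unfolding pol_seq_eq_var_diffs mem_ideal_sum_seq_var_diffs[OF W finite_pol_vars trW L one] .
    moreover have "relab (merge (set ?L)) 1 = (1 :: (nat \<times> nat, 'k) mpol)"
      using relab_single[of "merge (set ?L)" 0 "1 :: 'k"] by simp
    ultimately have "(1 :: (nat \<times> nat, 'k) mpol) \<in> support_ideal ?V (merged ?V ?W (set ?L))" by simp
    then have "{} \<in> merged ?V ?W (set ?L)"
      unfolding support_ideal_iff[OF upset_merged[OF W]] by simp
    then have "{} \<in> ?W" by (simp add: merged_def merge_vimage_def)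
    then show False by (auto simp: up_closure_def part_support_def Gam_def)
  qed
  with reg one have regseq: "regular_sequence ?R (quot_module ?R (support_ideal ?V ?W)) (pol_seq n r)"
    unfolding regular_sequence_iff[OF J fs] by blast
  have ideal_eq: "support_ideal ?V ?W = part_ideal n (n - d + 1) r ?Q"
    by (rule part_ideal_eq[OF Q, symmetric])
  have "sqfree_monomial_ideal ?V (support_ideal ?V ?W :: (nat \<times> nat, 'k) mpol set)"
    unfolding sqfree_monomial_ideal_def using part_support_subset[OF Q]
    by (intro exI[of _ ?B] conjI Idl_sqfree_monom[symmetric] finite_pol_vars) auto
  moreover have "monomial_ideal {1..n} (sqfree_ideal n (n - d + 1) :: (nat, 'k) mpol set)"
  proof -
    \<comment> \<open>The indicator exponent vector of \<open>\<sigma>\<close>, turning square-free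
      generators into the form that \<open>monomial_ideal\<close> asks for.\<close>
    let ?e = "\<lambda>\<sigma>. \<Sum>v \<in> \<sigma>. Poly_Mapping.single v (1::nat)"
    have fin: "finite \<sigma>" if "\<sigma> \<in> Gam n (n - d + 1)" for \<sigma>
      using that finite_subset[of \<sigma> "{1..n}"] by (auto simp: Gam_def)
    have "sqfree_monom \<sigma> = (monom_of (?e \<sigma>) :: (nat, 'k) mpol)" if "\<sigma> \<in> Gam n (n - d + 1)" for \<sigma>
    proof -
      have "Poly_Mapping.lookup (?e \<sigma>) v = 1" if "v \<in> \<sigma>" for v
        using fin[OF \<open>\<sigma> \<in> _\<close>] that by (simp add: lookup_sum lookup_single when_def sum.delta)
      then show ?thesis
        unfolding monom_of_def sqfree_monom_def keys_sum_single[OF fin[OF that]] by simp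
    qed
    then have eq: "sqfree_monom ` Gam n (n - d + 1) = (monom_of ` ?e ` Gam n (n - d + 1) :: (nat, 'k) mpol set)"
      unfolding image_image by (rule image_cong[OF refl])
    have "\<forall>m \<in> ?e ` Gam n (n - d + 1). Poly_Mapping.keys m \<subseteq> {1..n}"
      using keys_sum_single[OF fin] by (auto simp: Gam_def simp del: One_nat_def)
    then show ?thesis
      unfolding monomial_ideal_def sqfree_ideal_def eq by blast
  qed
  ultimately have "is_polarization n r (alexander_dual ?V It) (sqfree_ideal n (n - d + 1) :: (nat, 'k) mpol set)"
    unfolding is_polarization_def Let_def dual
    using r regseq depol_kernel[OF r J reg] depol_part_ideal[OF Q r, unfolded part_ideal_eq[OF Q]] by blast
  then show ?thesis
    using alexander_dual_sqfree_ideal[OF d(2), where 'k = 'k] Q dual ideal_eq by simp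
qed

end
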